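(* Let $R$ be a unital topological ring and let $\pi\colon\Lambda\to\Gamma$ be a continuous $R$-bundle, where $\Gamma$ is an étale locally $R$-normal semigroupoid. Let $\sim$ be a bundle congruence on $\pi$, and let $p_\Lambda\colon\Lambda\to\Lambda/\!\sim$ be the quotient map. Then the map \[T\colon\mathcal{A}(\pi)\to\mathcal{A}(\pi/\!\sim),\qquad T(\alpha)(x)=\sum_{\gamma\in x}p_\Lambda(\alpha(\gamma))\qquad(x\in\Gamma/\!\sim)\] determines an $R$-algebra homomorphism. Moreover, if $\sim_\Lambda$ is locally trivial, then $T$ is surjective.
   Context: A space has a property "locally" if every point has a neighbourhood basis (neighbourhoods not necessarily open) of subsets having that property in the subspace topology. A space $X$ is $R$-normal if for any disjoint closed $A,B\subseteq X$ there is a continuous $f\colon X\to R$ with $f=0$ on $A$, $f=1$ on $B$. A semigroupoid $\Lambda$ is a directed graph with vertex set $\Lambda^{(0)}$, source and range maps $\mathfrak{s},\mathfrak{r}\colon\Lambda\to\Lambda^{(0)}$, and an associative product $\Lambda^{(2)}=\{(a,b):\mathfrak{s}(a)=\mathfrak{r}(b)\}\to\Lambda$ with $\mathfrak{s}(ab)=\mathfrak{s}(b)$, $\mathfrak{r}(ab)=\mathfrak{r}(a)$. A homomorphism $\phi$ satisfies: $(a,b)$ composable implies $(\phi(a),\phi(b))$ composable and $\phi(ab)=\phi(a)\phi(b)$; it is rigid if conversely $(\phi(a),\phi(b))$ composable implies $(a,b)$ composable. Topological semigroupoid: $\mathfrak{s},\mathfrak{r}$ and product continuous. Étale: $\mathfrak{s},\mathfrak{r}$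 are local homeomorphisms and $\Lambda^{(0)}$ is locally compact Hausdorff. An $R$-bundle is a rigid semigroupoid homomorphism $\pi\colon\Lambda\to\Gamma$ with an $R$-bimodule structure on each fiber $\pi^{-1}(\gamma)$, $\gamma\in\Gamma$, such that for $(\gamma_1,\gamma_2)\in\Gamma^{(2)}$ the product $\pi^{-1}(\gamma_1)\times\pi^{-1}(\gamma_2)\to\pi^{-1}(\gamma_1\gamma_2)$ is biadditive, satisfies $(xr)y=x(ry)$, and induces an $R$-bimodule homomorphism on $\pi^{-1}(\gamma_1)\otimes_R\pi^{-1}(\gamma_2)$. $0_\gamma$ is the zero of $\pi^{-1}(\gamma)$. The bundle is continuous if $\Lambda,\Gamma$ are topological semigroupoids and $\pi$, the fiberwise addition, the left and right scalar multiplications, and $\gamma\mapsto0_\gamma$ are continuous. A section of $\pi$ is a map $\alpha\colon\Gamma\to\Lambda$ with $\pi\circ\alpha=\mathrm{id}_\Gamma$; $\operatorname{supp}(\alpha)$ is the closure of $\{\gamma:\alpha(\gamma)\ne0_\gamma\}$. For $V\subseteq\Gamma$ open, $C_c(V,\pi)$ is the set of sections that are zero outside $V$, continuous on $V$, with $\operatorname{supp}(\alpha)\cap V$ compact. For $\Gamma$ étale and locally $R$-normal, the sectional algebra $\mathcal{A}(\pi)$ is the $R$-bimodule (pointwise operations) generated by all $C_c(V,\pi)$, $V$ open Hausdorff, with product $(\alpha\ast\beta)(\gamma)=\sum_{ab=\gamma}\alpha(a)\beta(b)$. An equivalence relation on a space is open if the saturation of every open set is open; it is locally trivial if the space has a basis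 of open sets $U$ such that any two equivalent points of $U$ are equal. A rigid congruence on a semigroupoid is an equivalence relation $\sim$ such that $x\sim y$ implies $\mathfrak{s}(x)=\mathfrak{s}(y)$ and $\mathfrak{r}(x)=\mathfrak{r}(y)$, and $x_1\sim y_1$, $x_2\sim y_2$, $\mathfrak{s}(x_1)=\mathfrak{r}(x_2)$ imply $x_1x_2\sim y_1y_2$. The quotient $\Lambda/\!\sim$ by an open rigid congruence, with the quotient topology, is a topological semigroupoid over the same vertex space with $\overline{x}\,\overline{y}=\overline{xy}$; if $\Lambda$ is étale (and locally $R$-normal) so is the quotient. A bundle congruence $\sim$ on $\pi$ consists of open rigid congruences $\sim_\Gamma$ on $\Gamma$ and $\sim_\Lambda$ on $\Lambda$ such that: (i) $x\sim_\Lambda y$ implies $\pi(x)\sim_\Gamma\pi(y)$; (ii) if $x_1\sim_\Lambda x_2$, $y_1\sim_\Lambda y_2$, $\pi(x_1)=\pi(y_1)$, $\pi(x_2)=\pi(y_2)$, then $x_1+y_1\sim_\Lambda x_2+y_2$, and similarly $rx_1\sim_\Lambda rx_2$, $x_1r\sim_\Lambda x_2r$ for $r\in R$; (iii) if $\pi(x)\sim_\Gamma\pi(y)$ then there is $y'\in\Lambda$ with $y\sim_\Lambda y'$ and $\pi(x)=\pi(y')$. The quotient bundle $\pi/\!\sim\colon\Lambda/\!\sim_\Lambda\to\Gamma/\!\sim_\Gamma$ is the map induced by $\pi$, with fiberwise operations $p_\Lambda(x)+p_\Lambda(y)=p_\Lambda(x+y')$ ($y'\sim_\Lambda y$, $\pi(y')=\pi(x)$),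 $rp_\Lambda(x)=p_\Lambda(rx)$, $p_\Lambda(x)r=p_\Lambda(xr)$. In the formula for $T$, the sum over $\gamma$ in the $\sim_\Gamma$-class $x$ has finitely many nonzero terms and is taken in the fiber $(\pi/\!\sim)^{-1}(x)$. *)

theory Defs
  imports "HOL-Analysis.Analysis" "HOL-Algebra.FiniteProduct"
begin

text \<open>Unital topological rings. In contrast to \<^class>\<open>ring_1\<close>, the zero ring is allowed, and no
  separation axiom is imposed.\<close>

class topological_unital_ring =
  ring + monoid_mult + topological_ab_group_add + topological_semigroup_mult

definition ring_normal_space :: "'r::topological_unital_ring itself \<Rightarrow> 'x topology \<Rightarrow> bool" where
  "ring_normal_space R X \<longleftrightarrow>
     (\<forall>A B. closedin X A \<and> closedin X B \<and> disjnt A B \<longrightarrow>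
        (\<exists>f :: 'x \<Rightarrow> 'r. continuous_map X euclidean f \<and> (\<forall>x\<in>A. f x = 0) \<and> (\<forall>x\<in>B. f x = 1)))"

definition locally_ring_normal_space :: "'r::topological_unital_ring itself \<Rightarrow> 'x topology \<Rightarrow> bool" where
  "locally_ring_normal_space R X \<longleftrightarrow>
     neighbourhood_base_of (\<lambda>S. ring_normal_space R (subtopology X S)) X"

definition local_homeomorphism :: "'x topology \<Rightarrow> 'y topology \<Rightarrow> ('x \<Rightarrow> 'y) \<Rightarrow> bool" where
  "local_homeomorphism X Y f \<longleftrightarrow>
     (\<forall>x\<in>topspace X. \<exists>U. openin X U \<and> x \<in> U \<and> openin Y (f ` U) \<and>
        homeomorphic_map (subtopology X U) (subtopology Y (f ` U)) f)"

definition quotient_topology :: "'x topology \<Rightarrow> ('x \<times> 'x) set \<Rightarrow> 'x set topology" where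
  "quotient_topology X E =
     topology (\<lambda>\<U>. \<U> \<subseteq> topspace X // E \<and> openin X {x \<in> topspace X. E `` {x} \<in> \<U>})"

lemma openin_quotient_topology:
  "openin (quotient_topology X E) \<U> \<longleftrightarrow>
     \<U> \<subseteq> topspace X // E \<and> openin X {x \<in> topspace X. E `` {x} \<in> \<U>}"
proof -
  have "istopology (\<lambda>\<U>. \<U> \<subseteq> topspace X // E \<and> openin X {x \<in> topspace X. E `` {x} \<in> \<U>})"
    unfolding istopology_def
  proof (intro conjI allI impI)
    fix S T
    assume S: "S \<subseteq> topspace X // E \<and> openin X {x \<in> topspace X. E `` {x} \<in> S}"
      and T: "T \<subseteq> topspace X // E \<and> openin X {x \<in> topspace X. E `` {x} \<in> T}"
    show "S \<inter> T \<subseteq> topspace X // E" using S by blast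
    have "{x \<in> topspace X. E `` {x} \<in> S \<inter> T} =
        {x \<in> topspace X. E `` {x} \<in> S} \<inter> {x \<in> topspace X. E `` {x} \<in> T}" by blast
    then show "openin X {x \<in> topspace X. E `` {x} \<in> S \<inter> T}" using S T by auto
  next
    fix \<K>
    assume K: "\<forall>S\<in>\<K>. S \<subseteq> topspace X // E \<and> openin X {x \<in> topspace X. E `` {x} \<in> S}"
    show "\<Union>\<K> \<subseteq> topspace X // E" using K by blast
    have "{x \<in> topspace X. E `` {x} \<in> \<Union>\<K>} = (\<Union>S\<in>\<K>. {x \<in> topspace X. E `` {x} \<in> S})" by blast
    then show "openin X {x \<in> topspace X. E `` {x} \<in> \<Union>\<K>}" using K by auto
  qed
  then show ?thesis
    unfolding quotient_topology_def by (simp add: topology_inverse')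
qed

lemma topspace_quotient_topology [simp]: "topspace (quotient_topology X E) = topspace X // E"
proof -
  have "{x \<in> topspace X. E `` {x} \<in> topspace X // E} = topspace X"
    by (auto intro: quotientI)
  then have "openin (quotient_topology X E) (topspace X // E)"
    by (simp add: openin_quotient_topology)
  then show ?thesis
    by (meson openin_quotient_topology openin_subset openin_topspace subset_antisym)
qed

definition open_equiv :: "'x topology \<Rightarrow> ('x \<times> 'x) set \<Rightarrow> bool" where
  "open_equiv X E \<longleftrightarrow> equiv (topspace X) E \<and> (\<forall>U. openin X U \<longrightarrow> openin X (E `` U))"

definition locally_trivial_equiv :: "'x topology \<Rightarrow> ('x \<times> 'x) set \<Rightarrow> bool" where
  "locally_trivial_equiv X E \<longleftrightarrow>
     (\<exists>\<B>. openin X = arbitrary union_of (\<lambda>U. U \<in> \<B>) \<and>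
          (\<forall>U\<in>\<B>. \<forall>x\<in>U. \<forall>y\<in>U. (x, y) \<in> E \<longrightarrow> x = y))"

text \<open>The carriers (arrows and vertices) are the underlying sets of the two topologies. Vertices
  need not be arrows, and a vertex need not be the source or the range of any arrow.\<close>

record ('a, 'v) sgpd =
  arrow_space :: "'a topology"
  vertex_space :: "'v topology"
  src :: "'a \<Rightarrow> 'v"
  rng :: "'a \<Rightarrow> 'v"
  prd :: "'a \<Rightarrow> 'a \<Rightarrow> 'a"

abbreviation arrows :: "('a, 'v, 'm) sgpd_scheme \<Rightarrow> 'a set" where
  "arrows G \<equiv> topspace (arrow_space G)"

abbreviation vertices :: "('a, 'v, 'm) sgpd_scheme \<Rightarrow> 'v set" where
  "vertices G \<equiv> topspace (vertex_space G)"

definition composable :: "('a, 'v, 'm) sgpd_scheme \<Rightarrow> ('a \<times> 'a) set" where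
  "composable G = {(a, b). a \<in> arrows G \<and> b \<in> arrows G \<and> src G a = rng G b}"

locale semigroupoid =
  fixes G :: "('a, 'v, 'm) sgpd_scheme"
  assumes src_closed: "a \<in> arrows G \<Longrightarrow> src G a \<in> vertices G"
    and rng_closed: "a \<in> arrows G \<Longrightarrow> rng G a \<in> vertices G"
    and prd_closed: "(a, b) \<in> composable G \<Longrightarrow> prd G a b \<in> arrows G"
    and src_prd: "(a, b) \<in> composable G \<Longrightarrow> src G (prd G a b) = src G b"
    and rng_prd: "(a, b) \<in> composable G \<Longrightarrow> rng G (prd G a b) = rng G a"
    and prd_assoc: "\<lbrakk>(a, b) \<in> composable G; (b, c) \<in> composable G\<rbrakk>
          \<Longrightarrow> prd G (prd G a b) c = prd G a (prd G b c)"

locale topological_semigroupoid = semigroupoid +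
  assumes continuous_src: "continuous_map (arrow_space G) (vertex_space G) (src G)"
    and continuous_rng: "continuous_map (arrow_space G) (vertex_space G) (rng G)"
    and continuous_prd:
      "continuous_map (subtopology (prod_topology (arrow_space G) (arrow_space G)) (composable G))
         (arrow_space G) (\<lambda>(a, b). prd G a b)"

locale etale_semigroupoid = topological_semigroupoid +
  assumes local_homeo_src: "local_homeomorphism (arrow_space G) (vertex_space G) (src G)"
    and local_homeo_rng: "local_homeomorphism (arrow_space G) (vertex_space G) (rng G)"
    and vertices_Hausdorff: "Hausdorff_space (vertex_space G)"
    and vertices_locally_compact: "neighbourhood_base_of (compactin (vertex_space G)) (vertex_space G)"

definition sgpd_hom ::
    "('a, 'v, 'm) sgpd_scheme \<Rightarrow> ('b, 'w, 'n) sgpd_scheme \<Rightarrow> ('a \<Rightarrow> 'b) set" where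
  "sgpd_hom G H = {\<phi>. \<phi> ` arrows G \<subseteq> arrows H \<and>
     (\<forall>(a, b) \<in> composable G. (\<phi> a, \<phi> b) \<in> composable H \<and> \<phi> (prd G a b) = prd H (\<phi> a) (\<phi> b))}"

definition rigid_hom ::
    "('a, 'v, 'm) sgpd_scheme \<Rightarrow> ('b, 'w, 'n) sgpd_scheme \<Rightarrow> ('a \<Rightarrow> 'b) set" where
  "rigid_hom G H = {\<phi> \<in> sgpd_hom G H.
     \<forall>a\<in>arrows G. \<forall>b\<in>arrows G. (\<phi> a, \<phi> b) \<in> composable H \<longrightarrow> (a, b) \<in> composable G}"

definition rigid_congruence :: "('a, 'v, 'm) sgpd_scheme \<Rightarrow> ('a \<times> 'a) set \<Rightarrow> bool" where
  "rigid_congruence G E \<longleftrightarrow>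
     equiv (arrows G) E \<and>
     (\<forall>(x, y) \<in> E. src G x = src G y \<and> rng G x = rng G y) \<and>
     (\<forall>(x1, y1) \<in> E. \<forall>(x2, y2) \<in> E. src G x1 = rng G x2 \<longrightarrow> (prd G x1 x2, prd G y1 y2) \<in> E)"

definition open_rigid_congruence :: "('a, 'v, 'm) sgpd_scheme \<Rightarrow> ('a \<times> 'a) set \<Rightarrow> bool" where
  "open_rigid_congruence G E \<longleftrightarrow> rigid_congruence G E \<and> open_equiv (arrow_space G) E"

text \<open>For a rigid congruence, every union below is a union of copies of one and the same class.\<close>

definition quotient_sgpd :: "('a, 'v) sgpd \<Rightarrow> ('a \<times> 'a) set \<Rightarrow> ('a set, 'v) sgpd" where
  "quotient_sgpd G E =
     \<lparr>arrow_space = quotient_topology (arrow_space G) E,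
      vertex_space = vertex_space G,
      src = (\<lambda>C. the_elem (src G ` C)),
      rng = (\<lambda>C. the_elem (rng G ` C)),
      prd = (\<lambda>C D. \<Union>a\<in>C. \<Union>b\<in>D. E `` {prd G a b})\<rparr>"

text \<open>Abelian groups are written as multiplicative HOL-Algebra monoids, so that \<^const>\<open>finprod\<close> is
  the finite sum. Bimodules are unital on both sides.\<close>

locale bimodule = comm_group M
  for M :: "('x, 'k) monoid_scheme" (structure) +
  fixes ls :: "'r::topological_unital_ring \<Rightarrow> 'x \<Rightarrow> 'x" and rs :: "'x \<Rightarrow> 'r \<Rightarrow> 'x"
  assumes ls_closed: "x \<in> carrier M \<Longrightarrow> ls r x \<in> carrier M"
    and ls_add: "\<lbrakk>x \<in> carrier M; y \<in> carrier M\<rbrakk> \<Longrightarrow> ls r (x \<otimes> y) = ls r x \<otimes> ls r y"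
    and ls_add_scalar: "x \<in> carrier M \<Longrightarrow> ls (r + s) x = ls r x \<otimes> ls s x"
    and ls_mult_scalar: "x \<in> carrier M \<Longrightarrow> ls (r * s) x = ls r (ls s x)"
    and ls_one: "x \<in> carrier M \<Longrightarrow> ls 1 x = x"
    and rs_closed: "x \<in> carrier M \<Longrightarrow> rs x r \<in> carrier M"
    and rs_add: "\<lbrakk>x \<in> carrier M; y \<in> carrier M\<rbrakk> \<Longrightarrow> rs (x \<otimes> y) r = rs x r \<otimes> rs y r"
    and rs_add_scalar: "x \<in> carrier M \<Longrightarrow> rs x (r + s) = rs x r \<otimes> rs x s"
    and rs_mult_scalar: "x \<in> carrier M \<Longrightarrow> rs x (r * s) = rs (rs x r) s"
    and rs_one: "x \<in> carrier M \<Longrightarrow> rs x 1 = x"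
    and ls_rs: "x \<in> carrier M \<Longrightarrow> rs (ls r x) s = ls r (rs x s)"

text \<open>\<^term>\<open>fadd\<close> is only meaningful on two elements of the same fiber.\<close>

record ('r, 'a, 'v, 'g, 'w) rbundle =
  total :: "('a, 'v) sgpd"
  base :: "('g, 'w) sgpd"
  proj :: "'a \<Rightarrow> 'g"
  fadd :: "'a \<Rightarrow> 'a \<Rightarrow> 'a"
  fzero :: "'g \<Rightarrow> 'a"
  flscale :: "'r \<Rightarrow> 'a \<Rightarrow> 'a"
  frscale :: "'a \<Rightarrow> 'r \<Rightarrow> 'a"

definition fiber :: "('r, 'a, 'v, 'g, 'w) rbundle \<Rightarrow> 'g \<Rightarrow> 'a set" where
  "fiber P \<gamma> = {x \<in> arrows (total P). proj P x = \<gamma>}"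

definition fiber_group :: "('r, 'a, 'v, 'g, 'w) rbundle \<Rightarrow> 'g \<Rightarrow> 'a monoid" where
  "fiber_group P \<gamma> = \<lparr>carrier = fiber P \<gamma>, mult = fadd P, one = fzero P \<gamma>\<rparr>"

text \<open>The last two axioms say that the balanced biadditive product induces a bimodule
  homomorphism on the tensor product of the two fibers over the ring.\<close>

locale R_bundle = total: semigroupoid "total P" + base: semigroupoid "base P"
  for P :: "('r::topological_unital_ring, 'a, 'v, 'g, 'w) rbundle" +
  assumes proj_rigid_hom: "proj P \<in> rigid_hom (total P) (base P)"
    and fiber_bimodule: "\<gamma> \<in> arrows (base P) \<Longrightarrow> bimodule (fiber_group P \<gamma>) (flscale P) (frscale P)"
    and prd_add_left: "\<lbrakk>(\<gamma>1, \<gamma>2) \<in> composable (base P);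
          x \<in> fiber P \<gamma>1; x' \<in> fiber P \<gamma>1; y \<in> fiber P \<gamma>2\<rbrakk>
        \<Longrightarrow> prd (total P) (fadd P x x') y = fadd P (prd (total P) x y) (prd (total P) x' y)"
    and prd_add_right: "\<lbrakk>(\<gamma>1, \<gamma>2) \<in> composable (base P);
          x \<in> fiber P \<gamma>1; y \<in> fiber P \<gamma>2; y' \<in> fiber P \<gamma>2\<rbrakk>
        \<Longrightarrow> prd (total P) x (fadd P y y') = fadd P (prd (total P) x y) (prd (total P) x y')"
    and prd_balanced: "\<lbrakk>(\<gamma>1, \<gamma>2) \<in> composable (base P); x \<in> fiber P \<gamma>1; y \<in> fiber P \<gamma>2\<rbrakk>
        \<Longrightarrow> prd (total P) (frscale P x r) y = prd (total P) x (flscale P r y)"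
    and prd_lscale: "\<lbrakk>(\<gamma>1, \<gamma>2) \<in> composable (base P); x \<in> fiber P \<gamma>1; y \<in> fiber P \<gamma>2\<rbrakk>
        \<Longrightarrow> prd (total P) (flscale P r x) y = flscale P r (prd (total P) x y)"
    and prd_rscale: "\<lbrakk>(\<gamma>1, \<gamma>2) \<in> composable (base P); x \<in> fiber P \<gamma>1; y \<in> fiber P \<gamma>2\<rbrakk>
        \<Longrightarrow> prd (total P) x (frscale P y r) = frscale P (prd (total P) x y) r"

locale continuous_R_bundle = R_bundle +
  assumes total_topological: "topological_semigroupoid (total P)"
    and base_topological: "topological_semigroupoid (base P)"
    and continuous_proj: "continuous_map (arrow_space (total P)) (arrow_space (base P)) (proj P)"
    and continuous_fadd:
      "continuous_map
         (subtopology (prod_topology (arrow_space (total P)) (arrow_space (total P)))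
            {(x, y). proj P x = proj P y})
         (arrow_space (total P)) (\<lambda>(x, y). fadd P x y)"
    and continuous_flscale:
      "continuous_map (prod_topology euclidean (arrow_space (total P)))
         (arrow_space (total P)) (\<lambda>(r, x). flscale P r x)"
    and continuous_frscale:
      "continuous_map (prod_topology (arrow_space (total P)) euclidean)
         (arrow_space (total P)) (\<lambda>(x, r). frscale P x r)"
    and continuous_fzero: "continuous_map (arrow_space (base P)) (arrow_space (total P)) (fzero P)"

text \<open>Infinite index sets are allowed as long as only finitely many terms are nonzero; otherwise
  the value is zero by convention.\<close>

definition fiber_sum ::
    "('r, 'a, 'v, 'g, 'w) rbundle \<Rightarrow> 'g \<Rightarrow> ('i \<Rightarrow> 'a) \<Rightarrow> 'i set \<Rightarrow> 'a" where
  "fiber_sum P \<gamma> f I = finprod (fiber_group P \<gamma>) f {i \<in> I. f i \<noteq> fzero P \<gamma>}"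

text \<open>Sections are extensional outside the arrows of the base, so that equality of functions is
  equality of sections.\<close>

definition sections :: "('r, 'a, 'v, 'g, 'w) rbundle \<Rightarrow> ('g \<Rightarrow> 'a) set" where
  "sections P = (\<Pi>\<^sub>E \<gamma>\<in>arrows (base P). fiber P \<gamma>)"

definition support :: "('r, 'a, 'v, 'g, 'w) rbundle \<Rightarrow> ('g \<Rightarrow> 'a) \<Rightarrow> 'g set" where
  "support P \<alpha> = arrow_space (base P) closure_of {\<gamma> \<in> arrows (base P). \<alpha> \<gamma> \<noteq> fzero P \<gamma>}"

definition Cc_sections :: "('r, 'a, 'v, 'g, 'w) rbundle \<Rightarrow> 'g set \<Rightarrow> ('g \<Rightarrow> 'a) set" where
  "Cc_sections P V = {\<alpha> \<in> sections P.
     (\<forall>\<gamma> \<in> arrows (base P) - V. \<alpha> \<gamma> = fzero P \<gamma>) \<and>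
     continuous_map (subtopology (arrow_space (base P)) V) (arrow_space (total P)) \<alpha> \<and>
     compactin (arrow_space (base P)) (support P \<alpha> \<inter> V)}"

definition section_zero :: "('r, 'a, 'v, 'g, 'w) rbundle \<Rightarrow> 'g \<Rightarrow> 'a" where
  "section_zero P = (\<lambda>\<gamma>\<in>arrows (base P). fzero P \<gamma>)"

definition section_add ::
    "('r, 'a, 'v, 'g, 'w) rbundle \<Rightarrow> ('g \<Rightarrow> 'a) \<Rightarrow> ('g \<Rightarrow> 'a) \<Rightarrow> 'g \<Rightarrow> 'a" where
  "section_add P \<alpha> \<beta> = (\<lambda>\<gamma>\<in>arrows (base P). fadd P (\<alpha> \<gamma>) (\<beta> \<gamma>))"

definition section_lscale ::
    "('r, 'a, 'v, 'g, 'w) rbundle \<Rightarrow> 'r \<Rightarrow> ('g \<Rightarrow> 'a) \<Rightarrow> 'g \<Rightarrow> 'a" where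
  "section_lscale P r \<alpha> = (\<lambda>\<gamma>\<in>arrows (base P). flscale P r (\<alpha> \<gamma>))"

definition section_rscale ::
    "('r, 'a, 'v, 'g, 'w) rbundle \<Rightarrow> ('g \<Rightarrow> 'a) \<Rightarrow> 'r \<Rightarrow> 'g \<Rightarrow> 'a" where
  "section_rscale P \<alpha> r = (\<lambda>\<gamma>\<in>arrows (base P). frscale P (\<alpha> \<gamma>) r)"

definition convolution ::
    "('r, 'a, 'v, 'g, 'w) rbundle \<Rightarrow> ('g \<Rightarrow> 'a) \<Rightarrow> ('g \<Rightarrow> 'a) \<Rightarrow> 'g \<Rightarrow> 'a" where
  "convolution P \<alpha> \<beta> = (\<lambda>\<gamma>\<in>arrows (base P).
     fiber_sum P \<gamma> (\<lambda>(a, b). prd (total P) (\<alpha> a) (\<beta> b))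
       {(a, b) \<in> composable (base P). prd (base P) a b = \<gamma>})"

text \<open>The sub-bimodule of the bimodule of sections generated by the spaces \<^const>\<open>Cc_sections\<close>;
  additive inverses are obtained by scaling with \<^term>\<open>-1\<close>.\<close>

inductive_set sectional_carrier ::
    "('r, 'a, 'v, 'g, 'w) rbundle \<Rightarrow> ('g \<Rightarrow> 'a) set"
  for P :: "('r, 'a, 'v, 'g, 'w) rbundle" where
  generator: "\<lbrakk>openin (arrow_space (base P)) V;
      Hausdorff_space (subtopology (arrow_space (base P)) V); \<alpha> \<in> Cc_sections P V\<rbrakk>
    \<Longrightarrow> \<alpha> \<in> sectional_carrier P"
| zero: "section_zero P \<in> sectional_carrier P"
| add: "\<lbrakk>\<alpha> \<in> sectional_carrier P; \<beta> \<in> sectional_carrier P\<rbrakk>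
    \<Longrightarrow> section_add P \<alpha> \<beta> \<in> sectional_carrier P"
| lscale: "\<alpha> \<in> sectional_carrier P \<Longrightarrow> section_lscale P r \<alpha> \<in> sectional_carrier P"
| rscale: "\<alpha> \<in> sectional_carrier P \<Longrightarrow> section_rscale P \<alpha> r \<in> sectional_carrier P"

record ('r, 'm) ralgebra =
  acarrier :: "'m set"
  aadd :: "'m \<Rightarrow> 'm \<Rightarrow> 'm"
  amult :: "'m \<Rightarrow> 'm \<Rightarrow> 'm"
  alscale :: "'r \<Rightarrow> 'm \<Rightarrow> 'm"
  arscale :: "'m \<Rightarrow> 'r \<Rightarrow> 'm"

definition sectional_algebra ::
    "('r, 'a, 'v, 'g, 'w) rbundle \<Rightarrow> ('r, 'g \<Rightarrow> 'a) ralgebra" where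
  "sectional_algebra P =
     \<lparr>acarrier = sectional_carrier P,
      aadd = section_add P,
      amult = convolution P,
      alscale = section_lscale P,
      arscale = section_rscale P\<rparr>"

definition ralgebra_hom :: "('r, 'm) ralgebra \<Rightarrow> ('r, 'n) ralgebra \<Rightarrow> ('m \<Rightarrow> 'n) set" where
  "ralgebra_hom A B = {T \<in> acarrier A \<rightarrow> acarrier B.
     (\<forall>\<alpha>\<in>acarrier A. \<forall>\<beta>\<in>acarrier A. T (aadd A \<alpha> \<beta>) = aadd B (T \<alpha>) (T \<beta>)) \<and>
     (\<forall>\<alpha>\<in>acarrier A. \<forall>\<beta>\<in>acarrier A. T (amult A \<alpha> \<beta>) = amult B (T \<alpha>) (T \<beta>)) \<and>
     (\<forall>r. \<forall>\<alpha>\<in>acarrier A. T (alscale A r \<alpha>) = alscale B r (T \<alpha>)) \<and>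
     (\<forall>r. \<forall>\<alpha>\<in>acarrier A. T (arscale A \<alpha> r) = arscale B (T \<alpha>) r)}"

text \<open>\<^term>\<open>EG\<close> is the congruence on the base and \<^term>\<open>EL\<close> the one on the total semigroupoid.\<close>

locale bundle_congruence =
  fixes P :: "('r, 'a, 'v, 'g, 'w) rbundle"
    and EG :: "('g \<times> 'g) set" and EL :: "('a \<times> 'a) set"
  assumes base_congruence: "open_rigid_congruence (base P) EG"
    and total_congruence: "open_rigid_congruence (total P) EL"
    and proj_cong: "(x, y) \<in> EL \<Longrightarrow> (proj P x, proj P y) \<in> EG"
    and fadd_cong: "\<lbrakk>(x1, x2) \<in> EL; (y1, y2) \<in> EL; proj P x1 = proj P y1; proj P x2 = proj P y2\<rbrakk>
        \<Longrightarrow> (fadd P x1 y1, fadd P x2 y2) \<in> EL"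
    and flscale_cong: "(x1, x2) \<in> EL \<Longrightarrow> (flscale P r x1, flscale P r x2) \<in> EL"
    and frscale_cong: "(x1, x2) \<in> EL \<Longrightarrow> (frscale P x1 r, frscale P x2 r) \<in> EL"
    and fiber_lift: "\<lbrakk>x \<in> arrows (total P); y \<in> arrows (total P); (proj P x, proj P y) \<in> EG\<rbrakk>
        \<Longrightarrow> \<exists>y'. (y, y') \<in> EL \<and> proj P x = proj P y'"

text \<open>For a bundle congruence, every union below is a nonempty union of copies of one and the same
  class; in the case of \<^const>\<open>fadd\<close> the representatives are chosen in a common fiber.\<close>

definition quotient_bundle ::
    "('r, 'a, 'v, 'g, 'w) rbundle \<Rightarrow> ('g \<times> 'g) set \<Rightarrow> ('a \<times> 'a) set
      \<Rightarrow> ('r, 'a set, 'v, 'g set, 'w) rbundle" where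
  "quotient_bundle P EG EL =
     \<lparr>total = quotient_sgpd (total P) EL,
      base = quotient_sgpd (base P) EG,
      proj = (\<lambda>C. \<Union>x\<in>C. EG `` {proj P x}),
      fadd = (\<lambda>C D. \<Union>x\<in>C. \<Union>y\<in>{y \<in> D. proj P y = proj P x}. EL `` {fadd P x y}),
      fzero = (\<lambda>c. \<Union>\<gamma>\<in>c. EL `` {fzero P \<gamma>}),
      flscale = (\<lambda>r C. \<Union>x\<in>C. EL `` {flscale P r x}),
      frscale = (\<lambda>C r. \<Union>x\<in>C. EL `` {frscale P x r})\<rparr>"

definition quotient_sum_map ::
    "('r, 'a, 'v, 'g, 'w) rbundle \<Rightarrow> ('g \<times> 'g) set \<Rightarrow> ('a \<times> 'a) set
      \<Rightarrow> ('g \<Rightarrow> 'a) \<Rightarrow> 'g set \<Rightarrow> 'a set" where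
  "quotient_sum_map P EG EL \<alpha> = (\<lambda>x\<in>arrows (base P) // EG.
     fiber_sum (quotient_bundle P EG EL) x (\<lambda>\<gamma>. EL `` {\<alpha> \<gamma>}) x)"

end

theory Submission
  imports Defs
begin

text \<open>Equivalent arrows of the base have the same source, and the source map of an etale
  semigroupoid is locally injective. Hence the quotient map \<open>q\<close> of the base, which is open and
  continuous, is locally injective, so it is a local homeomorphism, and a compact set of arrows
  meets every class in finitely many points (\<open>finite_compact_Int_vimage\<close>). This makes the sums
  defining \<open>T\<close> finite.

  The axioms of a bundle congruence say that the quotient map \<open>p\<close> of the total space restricts to
  an additive map from the fiber over \<open>\<gamma>\<close> onto the fiber over \<open>q \<gamma>\<close> that respects scalars
  (\<open>p_hom\<close>, \<open>fiber_Q_lift\<close>). The quotient fibers are therefore bimodules, \<open>T\<close> is linear, and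
  multiplicativity (\<open>T_mult\<close>) is a rearrangement: both sides at a class \<open>c\<close> are the sum of
  \<open>p (\<alpha> a \<beta> b)\<close> over the finite set of composable pairs with \<open>ab \<in> c\<close> and nonzero factors, grouped
  by the product \<open>ab\<close> on the left and by the pair of classes of \<open>a\<close> and \<open>b\<close> on the right.

  What remains is topological: \<open>T\<close> maps generators into the sectional algebra of the quotient, and
  reaches all of them when the congruence on the total space is locally trivial. If \<open>\<alpha>\<close> is supported
  in an open set on which \<open>q\<close> is injective, no summation takes place and \<open>T \<alpha>\<close> is the transport of
  \<open>p \<circ> \<alpha>\<close> along a homeomorphism. If the congruence on the total space is locally trivial, then \<open>p\<close> is
  a local homeomorphism as well, so a continuous section of the quotient lifts near every
  arrow to a continuous section of the bundle (\<open>local_lift_of_section\<close>). In both cases the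
  statement thus holds for sections with small support, and a partition of unity reduces the general
  case to that one (\<open>Cc_sections_partition_of_unity\<close>). The functions used there come from the
  local \<open>R\<close>-normality of the base; they are transported to the quotient along \<open>q\<close>.\<close>

section \<open>Open maps and locally injective maps\<close>

lemma homeomorphic_map_open_inj:
  assumes "continuous_map X Y q" "open_map X Y q" "openin X U" "inj_on q U"
  shows "homeomorphic_map (subtopology X U) (subtopology Y (q ` U)) q"
proof (rule bijective_open_imp_homeomorphic_map)
  have U: "U \<subseteq> topspace X" using assms(3) by (rule openin_subset)
  have qU: "q ` U \<subseteq> topspace Y" using U assms(1) by (auto simp: continuous_map_def)
  show "continuous_map (subtopology X U) (subtopology Y (q ` U)) q"
    using assms(1) by (auto simp: continuous_map_in_subtopology continuous_map_from_subtopology)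
  have "open_map (subtopology X U) Y q"
    using assms by (simp add: open_map_from_subtopology)
  then show "open_map (subtopology X U) (subtopology Y (q ` U)) q"
    using U by (intro open_map_into_subtopology) auto
  show "q ` topspace (subtopology X U) = topspace (subtopology Y (q ` U))"
    using U qU by auto
  show "inj_on q (topspace (subtopology X U))"
    using U assms(4) by (simp add: Int_absorb1 inf.absorb2)
qed

lemma continuous_inv_into_open_inj:
  assumes "open_map X Y q" "openin X U" "inj_on q U" "q \<in> topspace X \<rightarrow> topspace Y"
  shows "continuous_map (subtopology Y (q ` U)) X (inv_into U q)"
  unfolding continuous_map_def
proof (intro conjI allI impI)
  have U: "U \<subseteq> topspace X" using assms(2) by (rule openin_subset)
  show "inv_into U q \<in> topspace (subtopology Y (q ` U)) \<rightarrow> topspace X"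
    using U by (auto simp: inv_into_into assms)
  fix W assume W: "openin X W"
  have "{y \<in> topspace (subtopology Y (q ` U)). inv_into U q y \<in> W} = q ` (U \<inter> W)"
    using assms(3,4) U by (auto simp: inv_into_f_f image_iff)
  moreover have "openin Y (q ` (U \<inter> W))"
    using assms(1,2) W by (auto simp: open_map_def)
  ultimately show "openin (subtopology Y (q ` U)) {y \<in> topspace (subtopology Y (q ` U)). inv_into U q y \<in> W}"
    by (auto simp: openin_subtopology)
qed

lemma compactin_closed_in_Hausdorff_subspace:
  assumes "compactin X K" "K \<subseteq> V" "Hausdorff_space (subtopology X V)"
  shows "closedin (subtopology X V) K"
  using assms by (intro compactin_imp_closedin) (auto simp: compactin_subtopology)

text \<open>The ambient space need not be Hausdorff, so \<open>K\<close> need not be closed in it and the closure of \<open>S\<close> may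
  leave \<open>K\<close>; inside the Hausdorff subspace \<open>V\<close> it cannot. This is why supports of sections are only
  controlled after intersecting with \<open>V\<close>.\<close>

lemma compactin_closure_Int:
  assumes "compactin X K" "K \<subseteq> V" "Hausdorff_space (subtopology X V)" "S \<subseteq> K"
  shows "compactin X (X closure_of S \<inter> V)"
proof -
  have K: "closedin (subtopology X V) K"
    using assms compactin_closed_in_Hausdorff_subspace by blast
  then obtain D where D: "closedin X D" "K = D \<inter> V"
    by (auto simp: closedin_subtopology)
  have "X closure_of S \<subseteq> D"
    using assms(4) D by (intro closure_of_minimal) auto
  then have "X closure_of S \<inter> V = K \<inter> X closure_of S"
    using D assms(2) by auto
  then show ?thesis
    using assms(1) by (simp add: compact_Int_closedin)
qed

text \<open>The two open sets \<open>U\<close> and \<open>W - C\<close> cover \<open>W\<close>; the second is open because a compact subset of the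
  Hausdorff space \<open>W\<close> is closed there.\<close>

lemma continuous_map_extend_zero:
  fixes f :: "'x \<Rightarrow> 'b :: {zero, topological_space}"
  assumes "openin X U" "openin X W" "compactin X C" "C \<subseteq> U" "U \<subseteq> W"
    and "Hausdorff_space (subtopology X W)"
    and "continuous_map (subtopology X U) euclidean f"
    and "\<And>x. x \<in> W - C \<Longrightarrow> f x = 0"
  shows "continuous_map (subtopology X W) euclidean f"
proof (rule pasting_lemma[where I = UNIV and T = "\<lambda>b. if b then U else W - C"
        and f = "\<lambda>b. if b then f else (\<lambda>_. 0)"])
  have C: "closedin (subtopology X W) C"
    using assms by (intro compactin_closed_in_Hausdorff_subspace) auto
  have W: "W \<subseteq> topspace X" using assms(2) by (rule openin_subset)
  have "openin (subtopology X W) (W - C)"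
    using C W by (metis closedin_def topspace_subtopology_subset)
  moreover have "openin (subtopology X W) U"
    using assms(1,2,5) by (simp add: openin_open_subtopology)
  ultimately show "openin (subtopology X W) (if b then U else W - C)" for b
    by simp
  show "continuous_map (subtopology (subtopology X W) (if b then U else W - C)) euclidean
          (if b then f else (\<lambda>_. 0))" for b
    using assms(5,7) by (auto simp: subtopology_subtopology Int_absorb1 inf.absorb2)
qed (use assms in \<open>auto split: if_splits\<close>)

text \<open>Each of the finitely many open sets covering \<open>K\<close> contains at most one point of a given fiber of the
  locally injective map \<open>h\<close>.\<close>

lemma finite_compact_Int_vimage:
  assumes "compactin X K"
    and "\<And>x. x \<in> topspace X \<Longrightarrow> \<exists>U. openin X U \<and> x \<in> U \<and> inj_on h U"
  shows "finite {x \<in> K. h x = v}"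
proof -
  have "K \<subseteq> \<Union>{U. openin X U \<and> inj_on h U}"
    using assms(2) compactin_subset_topspace[OF assms(1)] by blast
  then have "\<exists>\<F>. finite \<F> \<and> \<F> \<subseteq> {U. openin X U \<and> inj_on h U} \<and> K \<subseteq> \<Union>\<F>"
    using assms(1) by (intro compactinD) auto
  then obtain \<F> where F: "finite \<F>" "\<F> \<subseteq> {U. openin X U \<and> inj_on h U}" "K \<subseteq> \<Union>\<F>"
    by blast
  have "finite {x \<in> U. h x = v}" if "U \<in> \<F>" for U
  proof -
    have "inj_on h {x \<in> U. h x = v}"
      using F(2) that by (auto intro: inj_on_subset)
    moreover have "finite (h ` {x \<in> U. h x = v})"
      by (rule finite_subset[of _ "{v}"]) auto
    ultimately show ?thesis by (rule finite_imageD[rotated])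
  qed
  then have "finite (\<Union>U\<in>\<F>. {x \<in> U. h x = v})"
    using F(1) by blast
  then show ?thesis
    by (rule rev_finite_subset) (use F(3) in auto)
qed

section \<open>Bump functions with values in a topological ring\<close>

text \<open>The bump function is continuous only on a neighbourhood \<open>U\<close> of its support: in a space that is merely
  locally Hausdorff, its extension by zero may fail to be continuous. In this form the property passes
  to images under local homeomorphisms.\<close>

definition bump_space :: "'r::topological_unital_ring itself \<Rightarrow> 'x topology \<Rightarrow> bool" where
  "bump_space R X \<longleftrightarrow>
     (\<forall>W x. openin X W \<and> x \<in> W \<longrightarrow>
        (\<exists>U O' C (f :: 'x \<Rightarrow> 'r). openin X U \<and> openin X O' \<and> compactin X C \<and>
           x \<in> O' \<and> O' \<subseteq> C \<and> C \<subseteq> U \<and> U \<subseteq> W \<and>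
           continuous_map (subtopology X U) euclidean f \<and>
           (\<forall>y\<in>O'. f y = 1) \<and> (\<forall>y\<in>U - C. f y = 0)))"

lemma bump_spaceE:
  fixes X :: "'x topology"
  assumes "bump_space TYPE('r::topological_unital_ring) X" "openin X W" "x \<in> W"
  obtains U O' C and f :: "'x \<Rightarrow> 'r::topological_unital_ring" where
    "openin X U" "openin X O'" "compactin X C" "x \<in> O'" "O' \<subseteq> C" "C \<subseteq> U" "U \<subseteq> W"
    "continuous_map (subtopology X U) euclidean f"
    "\<And>y. y \<in> O' \<Longrightarrow> f y = 1" "\<And>y. y \<in> U - C \<Longrightarrow> f y = 0"
proof -
  have "\<exists>U O' C (f :: 'x \<Rightarrow> 'r). openin X U \<and> openin X O' \<and> compactin X C \<and>
           x \<in> O' \<and> O' \<subseteq> C \<and> C \<subseteq> U \<and> U \<subseteq> W \<and>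
           continuous_map (subtopology X U) euclidean f \<and>
           (\<forall>y\<in>O'. f y = 1) \<and> (\<forall>y\<in>U - C. f y = 0)"
    using assms by (simp add: bump_space_def)
  then show ?thesis
    by (elim exE conjE) (rule that, assumption+, simp_all)
qed

text \<open>Inside an open Hausdorff set the bump functions can be extended by zero.\<close>

lemma bump_in_Hausdorff_open:
  fixes X :: "'x topology"
  assumes "bump_space TYPE('r::topological_unital_ring) X"
    and "openin X V" "Hausdorff_space (subtopology X V)" "openin X U" "x \<in> U" "U \<subseteq> V"
  obtains O' C and f :: "'x \<Rightarrow> 'r::topological_unital_ring" where
    "openin X O'" "x \<in> O'" "compactin X C" "C \<subseteq> U"
    "continuous_map (subtopology X V) euclidean f"
    "\<And>y. y \<in> O' \<Longrightarrow> f y = 1" "\<And>y. y \<notin> C \<Longrightarrow> f y = 0"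
proof -
  obtain U' O' C and f :: "'x \<Rightarrow> 'r" where *:
    "openin X U'" "openin X O'" "compactin X C" "x \<in> O'" "O' \<subseteq> C" "C \<subseteq> U'" "U' \<subseteq> U"
    "continuous_map (subtopology X U') euclidean f"
    "\<And>y. y \<in> O' \<Longrightarrow> f y = 1" "\<And>y. y \<in> U' - C \<Longrightarrow> f y = 0"
    by (rule bump_spaceE[OF assms(1,4,5)]) auto
  define g where "g y = (if y \<in> C then f y else 0)" for y
  have "continuous_map (subtopology X U') euclidean g"
    using *(8) by (rule continuous_map_eq) (use *(10) in \<open>auto simp: g_def\<close>)
  then have "continuous_map (subtopology X V) euclidean g"
    using * assms by (intro continuous_map_extend_zero[of X U' V C]) (auto simp: g_def)
  then show ?thesis
    using * by (intro that[of O' C g]) (auto simp: g_def)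
qed

lemma local_homeomorphism_inj:
  assumes "local_homeomorphism X Y s" "x \<in> topspace X"
  shows "\<exists>U. openin X U \<and> x \<in> U \<and> inj_on s U"
proof -
  obtain U where U: "openin X U" "x \<in> U" "homeomorphic_map (subtopology X U) (subtopology Y (s ` U)) s"
    using assms by (auto simp: local_homeomorphism_def)
  have "inj_on s U"
    using homeomorphic_imp_injective_map[OF U(3)] openin_subset[OF U(1)] by (simp add: inf.absorb2)
  then show ?thesis using U by blast
qed

text \<open>Compact neighbourhoods in the target, taken inside the image of a set on which \<open>s\<close> is a
  homeomorphism, are pulled back.\<close>

lemma local_homeomorphism_compact_base:
  assumes "local_homeomorphism X Y s" "neighbourhood_base_of (compactin Y) Y"
  shows "neighbourhood_base_of (compactin X) X"
  unfolding neighbourhood_base_of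
proof (intro allI impI, elim conjE)
  fix W x assume W: "openin X W" "x \<in> W"
  obtain U where U: "openin X U" "x \<in> U" "openin Y (s ` U)" 
      "homeomorphic_map (subtopology X U) (subtopology Y (s ` U)) s"
    using assms(1) openin_subset[OF W(1)] W(2) unfolding local_homeomorphism_def by blast
  have UX: "U \<subseteq> topspace X" using U(1) by (rule openin_subset)
  then have top: "topspace (subtopology X U) = U" by auto
  have inj: "inj_on s U"
    using homeomorphic_imp_injective_map[OF U(4)] top by simp
  have "openin (subtopology Y (s ` U)) (s ` (W \<inter> U))"
    using U W top by (metis homeomorphic_imp_open_map inf_le2 openin_Int openin_open_subtopology open_map_def)
  then have "openin Y (s ` (W \<inter> U))"
    using U(3) openin_trans_full by blast
  then obtain A K where A: "openin Y A" "compactin Y K" "s x \<in> A" "A \<subseteq> K" "K \<subseteq> s ` (W \<inter> U)"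
    using assms(2) U(2) W(2) unfolding neighbourhood_base_of by (metis IntI imageI)
  define K' where "K' = {y \<in> U. s y \<in> K}"
  define A' where "A' = {y \<in> U. s y \<in> A}"
  have "s ` K' = K" using A(5) by (auto simp: K'_def)
  moreover have "compactin (subtopology Y (s ` U)) K"
    using A by (auto simp: compactin_subtopology)
  ultimately have "compactin (subtopology X U) K'"
    using homeomorphic_map_compactness[OF U(4), of K'] top by (auto simp: K'_def)
  then have "compactin X K'" by (simp add: compactin_subtopology)
  moreover have "openin X A'"
  proof -
    have "continuous_map (subtopology X U) Y s"
      using homeomorphic_imp_continuous_map[OF U(4)] continuous_map_into_fulltopology by blast
    then have "openin (subtopology X U) A'"
      using A(1) unfolding A'_def continuous_map_def top by auto
    then show ?thesis using U(1) openin_trans_full by blast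
  qed
  moreover have "K' \<subseteq> W"
    using A(5) inj by (auto simp: K'_def inj_on_def)
  ultimately show "\<exists>U V. openin X U \<and> compactin X V \<and> x \<in> U \<and> U \<subseteq> V \<and> V \<subseteq> W"
    using A U by (intro exI[of _ A'] exI[of _ K']) (auto simp: A'_def K'_def)
qed

lemma local_homeomorphism_Hausdorff:
  assumes "local_homeomorphism X Y s" "Hausdorff_space Y" "x \<in> topspace X"
  shows "\<exists>U. openin X U \<and> x \<in> U \<and> Hausdorff_space (subtopology X U)"
proof -
  obtain U where U: "openin X U" "x \<in> U" 
      "homeomorphic_map (subtopology X U) (subtopology Y (s ` U)) s"
    using assms(1,3) unfolding local_homeomorphism_def by blast
  then have "Hausdorff_space (subtopology X U)"
    using assms(2) Hausdorff_space_subtopology homeomorphic_Hausdorff_space homeomorphic_space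
      homeomorphic_map_maps homeomorphic_space_def by metis
  then show ?thesis using U by blast
qed

text \<open>Nest neighbourhoods of the point, \<open>A' \<subseteq> C' \<subseteq> A \<subseteq> C \<subseteq> U \<subseteq> N\<close>, with \<open>N\<close> normal and \<open>C\<close>, \<open>C'\<close> compact,
  all inside a Hausdorff neighbourhood. Normality of \<open>N\<close> separates \<open>C'\<close> from the complement of \<open>A\<close>.\<close>

lemma bump_spaceI:
  fixes X :: "'x topology"
  assumes normal: "locally_ring_normal_space TYPE('r::topological_unital_ring) X"
    and cpt: "neighbourhood_base_of (compactin X) X"
    and Haus: "\<And>x. x \<in> topspace X \<Longrightarrow> \<exists>U. openin X U \<and> x \<in> U \<and> Hausdorff_space (subtopology X U)"
  shows "bump_space TYPE('r) X"
  unfolding bump_space_def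
proof (intro allI impI, elim conjE)
  fix W x assume W: "openin X W" "x \<in> W"
  obtain H where H: "openin X H" "x \<in> H" "Hausdorff_space (subtopology X H)"
    using Haus openin_subset[OF W(1)] W(2) by blast
  have "openin X (W \<inter> H)" "x \<in> W \<inter> H" using W H by auto
  then obtain U N where U: "openin X U" "x \<in> U" "U \<subseteq> N" "N \<subseteq> W \<inter> H"
      and N: "ring_normal_space TYPE('r) (subtopology X N)"
    using normal unfolding locally_ring_normal_space_def neighbourhood_base_of by meson
  obtain A C where A: "openin X A" "compactin X C" "x \<in> A" "A \<subseteq> C" "C \<subseteq> U"
    using cpt U(1,2) unfolding neighbourhood_base_of by meson
  \<comment> \<open>The second, smaller compact neighbourhood is where the function is to equal 1.\<close>
  obtain A' C' where A': "openin X A'" "compactin X C'" "x \<in> A'" "A' \<subseteq> C'" "C' \<subseteq> A"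
    using cpt A(1,3) unfolding neighbourhood_base_of by meson
  have NX: "N \<subseteq> topspace X" using U(4) openin_subset[OF H(1)] by auto
  have "Hausdorff_space (subtopology (subtopology X H) N)"
    using H(3) Hausdorff_space_subtopology by blast
  moreover have "subtopology (subtopology X H) N = subtopology X N"
    using U(4) by (auto simp: subtopology_subtopology Int_absorb1)
  ultimately have "Hausdorff_space (subtopology X N)" by simp
  then have "closedin (subtopology X N) C'"
    using A A' U by (intro compactin_closed_in_Hausdorff_subspace) auto
  moreover have "closedin (subtopology X N) (N - A)"
    using A U NX by (auto simp: closedin_def openin_subtopology Diff_Diff_Int)
  moreover have "disjnt (N - A) C'" using A' by (auto simp: disjnt_def)
  ultimately obtain f :: "'x \<Rightarrow> 'r" where f: "continuous_map (subtopology X N) euclidean f"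
      "\<And>y. y \<in> N - A \<Longrightarrow> f y = 0" "\<And>y. y \<in> C' \<Longrightarrow> f y = 1"
    using N unfolding ring_normal_space_def by meson
  have f_cont: "continuous_map (subtopology X U) euclidean f"
    using f(1) U(3) continuous_map_from_subtopology_mono by blast
  show "\<exists>U O' C (f :: 'x \<Rightarrow> 'r). openin X U \<and> openin X O' \<and> compactin X C \<and>
           x \<in> O' \<and> O' \<subseteq> C \<and> C \<subseteq> U \<and> U \<subseteq> W \<and>
           continuous_map (subtopology X U) euclidean f \<and>
           (\<forall>y\<in>O'. f y = 1) \<and> (\<forall>y\<in>U - C. f y = 0)"
  proof (rule exI[of _ U], rule exI[of _ A'], rule exI[of _ C], rule exI[of _ f], intro conjI ballI)
    show "f y = 1" if "y \<in> A'" for y using that A'(4) f(3) by blast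
    show "f y = 0" if "y \<in> U - C" for y using that A(4) U(3) f(2) by blast
    show "A' \<subseteq> C" "U \<subseteq> W" using A(4) A'(4,5) U(3,4) by blast+
  qed fact+
qed

text \<open>An open continuous map that is locally injective is a local homeomorphism, so a bump function with small
  support can be transported along a local inverse.\<close>

lemma bump_space_open_image:
  fixes X :: "'x topology" and Y :: "'y topology"
  assumes X: "bump_space TYPE('r::topological_unital_ring) X"
    and q: "continuous_map X Y q" "open_map X Y q" "q ` topspace X = topspace Y"
    and inj: "\<And>x. x \<in> topspace X \<Longrightarrow> \<exists>U. openin X U \<and> x \<in> U \<and> inj_on q U"
  shows "bump_space TYPE('r) Y"
  unfolding bump_space_def
proof (intro allI impI, elim conjE)
  fix W y assume W: "openin Y W" "y \<in> W"
  obtain x where x: "x \<in> topspace X" "q x = y"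
    using W(2) q(3) openin_subset[OF W(1)] by (metis imageE subsetD)
  obtain V where V: "openin X V" "x \<in> V" "inj_on q V" using inj x by blast
  have "openin X (V \<inter> {x \<in> topspace X. q x \<in> W})" 
    using V W q(1) by (auto simp: continuous_map_def)
  moreover have "x \<in> V \<inter> {x \<in> topspace X. q x \<in> W}" using x V W by auto
  ultimately obtain U O' C and f :: "'x \<Rightarrow> 'r" where *:
    "openin X U" "openin X O'" "compactin X C" "x \<in> O'" "O' \<subseteq> C" "C \<subseteq> U" 
    "U \<subseteq> V \<inter> {x \<in> topspace X. q x \<in> W}"
    "continuous_map (subtopology X U) euclidean f"
    "\<And>y. y \<in> O' \<Longrightarrow> f y = 1" "\<And>y. y \<in> U - C \<Longrightarrow> f y = 0"
    by (rule bump_spaceE[OF X]) auto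
  have injU: "inj_on q U" using V(3) *(7) by (auto intro: inj_on_subset)
  define g where "g = f \<circ> inv_into U q"
  have g: "g (q z) = f z" if "z \<in> U" for z
    using that injU by (simp add: g_def)
  have "continuous_map (subtopology Y (q ` U)) X (inv_into U q)"
    using q *(1) injU by (intro continuous_inv_into_open_inj) auto
  then have "continuous_map (subtopology Y (q ` U)) (subtopology X U) (inv_into U q)"
    by (auto simp: continuous_map_in_subtopology inv_into_into)
  then have g_cont: "continuous_map (subtopology Y (q ` U)) euclidean g"
    unfolding g_def using *(8) continuous_map_compose by blast
  have "compactin Y (q ` C)" using *(3) q(1) by (rule image_compactin)
  have "openin Y (q ` U)" "openin Y (q ` O')"
    using * q(2) by (auto simp: open_map_def)
  show "\<exists>U O' C (f :: 'y \<Rightarrow> 'r). openin Y U \<and> openin Y O' \<and> compactin Y C \<and>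
           y \<in> O' \<and> O' \<subseteq> C \<and> C \<subseteq> U \<and> U \<subseteq> W \<and>
           continuous_map (subtopology Y U) euclidean f \<and>
           (\<forall>y\<in>O'. f y = 1) \<and> (\<forall>y\<in>U - C. f y = 0)"
  proof (rule exI[of _ "q ` U"], rule exI[of _ "q ` O'"], rule exI[of _ "q ` C"], rule exI[of _ g], intro conjI ballI)
    show "g z = 1" if z: "z \<in> q ` O'" for z
    proof -
      obtain w where "w \<in> O'" "z = q w" using z by auto
      then show ?thesis using g[of w] *(9)[of w] *(5,6) by (metis subsetD)
    qed
    show "g z = 0" if z: "z \<in> q ` U - q ` C" for z
    proof -
      obtain w where "w \<in> U" "z = q w" using z by (metis DiffD1 imageE)
      then show ?thesis using g[of w] *(10)[of w] z by (metis DiffD2 DiffI imageI)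
    qed
    show "y \<in> q ` O'" using *(4) x(2) by (metis imageI)
    show "q ` O' \<subseteq> q ` C" "q ` C \<subseteq> q ` U" using *(5,6) by (auto intro: image_mono)
    show "q ` U \<subseteq> W" using *(7) by auto
  qed fact+
qed

lemma continuous_map_times:
  fixes f g :: "'x \<Rightarrow> 'r::topological_unital_ring"
  assumes "continuous_map X euclidean f" "continuous_map X euclidean g"
  shows "continuous_map X euclidean (\<lambda>x. f x * g x)"
proof -
  have "continuous_on UNIV (\<lambda>z::'r \<times> 'r. fst z * snd z)"
    by (intro continuous_on_mult' continuous_intros)
  then have "continuous_map (prod_topology euclidean euclidean) euclidean (\<lambda>z::'r \<times> 'r. fst z * snd z)"
    by simp
  from continuous_map_compose[OF continuous_map_pairedI[OF assms] this] show ?thesis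
    by (simp add: o_def)
qed

lemma continuous_map_one_minus:
  fixes f :: "'x \<Rightarrow> 'r::topological_unital_ring"
  assumes "continuous_map X euclidean f"
  shows "continuous_map X euclidean (\<lambda>x. 1 - f x)"
proof -
  have "continuous_on UNIV (\<lambda>z::'r. 1 - z)"
    by (intro continuous_intros)
  then have "continuous_map euclidean euclidean (\<lambda>z::'r. 1 - z)"
    by simp
  from continuous_map_compose[OF assms this] show ?thesis
    by (simp add: o_def)
qed

section \<open>Finite sums in commutative groups and bimodules\<close>

text \<open>Fubini for finite sums: the terms are grouped along the fibers of \<open>h\<close>.\<close>

lemma (in comm_monoid) finprod_fibres:
  assumes "finite S" "f \<in> S \<rightarrow> carrier G"
  shows "finprod G (\<lambda>j. finprod G f {s \<in> S. h s = j}) (h ` S) = finprod G f S"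
proof -
  have "finprod G f (\<Union>j\<in>h ` S. {s \<in> S. h s = j}) = finprod G (\<lambda>j. finprod G f {s \<in> S. h s = j}) (h ` S)"
    using assms by (intro finprod_UN_disjoint) (auto simp: pairwise_def disjnt_def)
  moreover have "(\<Union>j\<in>h ` S. {s \<in> S. h s = j}) = S" by auto
  ultimately show ?thesis by simp
qed

lemma hom_finprod:
  assumes "comm_group G" "comm_group H" "h \<in> hom G H" "f \<in> A \<rightarrow> carrier G"
  shows "h (finprod G f A) = finprod H (\<lambda>a. h (f a)) A"
proof -
  interpret G: comm_group G by fact
  interpret H: comm_group H by fact
  interpret group_hom G H h
    using assms(3) by unfold_locales
  show ?thesis
    using assms(4)
  proof (induction A rule: infinite_finite_induct)
    case (insert a A)
    then have "f \<in> A \<rightarrow> carrier G" "f a \<in> carrier G" by auto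
    with insert show ?case
      by (simp add: G.finprod_insert H.finprod_insert Pi_iff)
  qed auto
qed

text \<open>Distributivity for a biadditive map between three different groups, as is the product of two fibers
  of a bundle.\<close>

lemma finprod_biadditive:
  assumes "comm_group G" "comm_group H" "comm_group K"
    and "\<And>y. y \<in> carrier H \<Longrightarrow> (\<lambda>x. b x y) \<in> hom G K"
    and "\<And>x. x \<in> carrier G \<Longrightarrow> b x \<in> hom H K"
    and "finite A" "finite C" "f \<in> A \<rightarrow> carrier G" "g \<in> C \<rightarrow> carrier H"
  shows "b (finprod G f A) (finprod H g C) = finprod K (\<lambda>(a, c). b (f a) (g c)) (A \<times> C)"
proof -
  interpret G: comm_group G by fact
  interpret H: comm_group H by fact
  interpret K: comm_group K by fact
  have cl: "b (f a) (g c) \<in> carrier K" if "a \<in> A" "c \<in> C" for a c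
    using assms(5)[of "f a"] assms(8,9) that by (auto simp: hom_def Pi_iff)
  have inner: "b (f a) (finprod H g C) = finprod K (\<lambda>(a, c). b (f a) (g c)) (Pair a ` C)" if "a \<in> A" for a
  proof -
    have "b (f a) (finprod H g C) = finprod K (\<lambda>c. b (f a) (g c)) C"
      using assms that by (intro hom_finprod) auto
    also have "\<dots> = finprod K (\<lambda>(a, c). b (f a) (g c)) (Pair a ` C)"
      using cl that by (subst K.finprod_reindex) (auto simp: inj_on_def)
    finally show ?thesis .
  qed
  have "b (finprod G f A) (finprod H g C) = finprod K (\<lambda>a. b (f a) (finprod H g C)) A"
    using assms by (intro hom_finprod[where h = "\<lambda>x. b x (finprod H g C)"]) auto
  also have "\<dots> = finprod K (\<lambda>a. finprod K (\<lambda>(a, c). b (f a) (g c)) (Pair a ` C)) A"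
    using inner cl by (intro K.finprod_cong') (auto intro!: K.finprod_closed)
  also have "\<dots> = finprod K (\<lambda>(a, c). b (f a) (g c)) (\<Union>a\<in>A. Pair a ` C)"
    using assms(6,7) cl by (intro K.finprod_UN_disjoint[symmetric]) (auto simp: pairwise_def disjnt_def)
  also have "(\<Union>a\<in>A. Pair a ` C) = A \<times> C" by auto
  finally show ?thesis .
qed

context bimodule
begin

lemma ls_zero: "x \<in> carrier M \<Longrightarrow> ls 0 x = \<one>"
  using ls_add_scalar[of x 0 0] ls_closed[of x 0] by (metis add_0 l_cancel_one' one_closed)

lemma ls_hom: "ls r \<in> hom M M"
  using ls_closed ls_add by (auto simp: hom_def)

lemma rs_hom: "(\<lambda>x. rs x r) \<in> hom M M"
  using rs_closed rs_add by (auto simp: hom_def)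

lemma ls_unit: "ls r \<one> = \<one>"
  using ls_hom hom_one is_group by blast

lemma rs_unit: "rs \<one> r = \<one>"
  using hom_one[OF rs_hom] is_group by blast

end

section \<open>Sections and partitions of unity\<close>

lemma fiber_group_simps [simp]:
  "carrier (fiber_group P \<gamma>) = fiber P \<gamma>"
  "mult (fiber_group P \<gamma>) = fadd P"
  "one (fiber_group P \<gamma>) = fzero P \<gamma>"
  by (simp_all add: fiber_group_def)

text \<open>A fiber sum ranges over the indices with nonzero terms, a set that changes with the summands. Sums of
  different families can only be compared after enlarging it to a common finite index set.\<close>

lemma fiber_sum_eq_finprod:
  assumes "comm_monoid (fiber_group P \<gamma>)" "finite F" "F \<subseteq> I"
    and "\<And>i. i \<in> F \<Longrightarrow> f i \<in> fiber P \<gamma>" "\<And>i. i \<in> I - F \<Longrightarrow> f i = fzero P \<gamma>"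
  shows "fiber_sum P \<gamma> f I = finprod (fiber_group P \<gamma>) f F"
proof -
  interpret comm_monoid "fiber_group P \<gamma>" by fact
  show ?thesis
    unfolding fiber_sum_def using assms(2-5)
    by (intro finprod_mono_neutral_cong_left) auto
qed

lemma sections_fiber: "\<alpha> \<in> sections P \<Longrightarrow> \<gamma> \<in> arrows (base P) \<Longrightarrow> \<alpha> \<gamma> \<in> fiber P \<gamma>"
  by (auto simp: sections_def)

lemma sections_undefined: "\<alpha> \<in> sections P \<Longrightarrow> \<gamma> \<notin> arrows (base P) \<Longrightarrow> \<alpha> \<gamma> = undefined"
  by (auto simp: sections_def PiE_def extensional_def)

lemma sections_eqI:
  assumes "\<alpha> \<in> sections P" "\<beta> \<in> sections P" "\<And>\<gamma>. \<gamma> \<in> arrows (base P) \<Longrightarrow> \<alpha> \<gamma> = \<beta> \<gamma>"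
  shows "\<alpha> = \<beta>"
  using assms unfolding sections_def by (rule PiE_ext)

lemma sections_restrict:
  assumes "\<And>\<gamma>. \<gamma> \<in> arrows (base P) \<Longrightarrow> \<alpha> \<gamma> \<in> fiber P \<gamma>"
  shows "(\<lambda>\<gamma>\<in>arrows (base P). \<alpha> \<gamma>) \<in> sections P"
  using assms by (auto simp: sections_def)

text \<open>For a Hausdorff open set, vanishing outside a compact subset is all that has to be checked about
  the support.\<close>

lemma Cc_sectionsI:
  assumes "Hausdorff_space (subtopology (arrow_space (base P)) V)"
    and "\<alpha> \<in> sections P" "compactin (arrow_space (base P)) K" "K \<subseteq> V"
    and "\<And>\<gamma>. \<gamma> \<in> arrows (base P) - K \<Longrightarrow> \<alpha> \<gamma> = fzero P \<gamma>"
    and "continuous_map (subtopology (arrow_space (base P)) V) (arrow_space (total P)) \<alpha>"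
  shows "\<alpha> \<in> Cc_sections P V"
proof -
  have "compactin (arrow_space (base P)) (support P \<alpha> \<inter> V)"
    unfolding support_def using assms by (intro compactin_closure_Int[of _ K]) auto
  then show ?thesis
    using assms by (auto simp: Cc_sections_def)
qed

lemma Cc_sections_compact:
  assumes "\<alpha> \<in> Cc_sections P V"
  obtains K where "compactin (arrow_space (base P)) K" "K \<subseteq> V"
    "\<And>\<gamma>. \<gamma> \<in> arrows (base P) - K \<Longrightarrow> \<alpha> \<gamma> = fzero P \<gamma>"
proof (rule that)
  show "compactin (arrow_space (base P)) (support P \<alpha> \<inter> V)"
    using assms by (simp add: Cc_sections_def)
  have "{\<gamma> \<in> arrows (base P). \<alpha> \<gamma> \<noteq> fzero P \<gamma>} \<subseteq> support P \<alpha>"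
    unfolding support_def by (rule closure_of_subset) auto
  then show "\<alpha> \<gamma> = fzero P \<gamma>" if "\<gamma> \<in> arrows (base P) - support P \<alpha> \<inter> V" for \<gamma>
    using assms that by (auto simp: Cc_sections_def)
qed auto

definition scale_section ::
    "('r, 'a, 'v, 'g, 'w) rbundle \<Rightarrow> ('g \<Rightarrow> 'r) \<Rightarrow> ('g \<Rightarrow> 'a) \<Rightarrow> 'g \<Rightarrow> 'a" where
  "scale_section P f \<alpha> = (\<lambda>\<gamma>\<in>arrows (base P). flscale P (f \<gamma>) (\<alpha> \<gamma>))"

lemma sectional_carrier_sections:
  assumes bimod: "\<And>\<gamma>. \<gamma> \<in> arrows (base P) \<Longrightarrow> bimodule (fiber_group P \<gamma>) (flscale P) (frscale P)"
  shows "sectional_carrier P \<subseteq> sections P"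
proof
  fix \<alpha> assume "\<alpha> \<in> sectional_carrier P"
  then show "\<alpha> \<in> sections P"
  proof induction
    case (generator V \<alpha>)
    then show ?case by (simp add: Cc_sections_def)
  next
    case zero
    then show ?case
      unfolding section_zero_def using bimodule.axioms(1)[OF bimod]
      by (intro sections_restrict) (metis comm_groupE(2) fiber_group_simps(1,3))
  next
    case (add \<alpha> \<beta>)
    then show ?case
      unfolding section_add_def using bimodule.axioms(1)[OF bimod]
      by (intro sections_restrict) (metis comm_groupE(1) fiber_group_simps(1,2) sections_fiber)
  next
    case (lscale \<alpha> r)
    then show ?case
      unfolding section_lscale_def using bimodule.ls_closed[OF bimod]
      by (intro sections_restrict) (metis fiber_group_simps(1) sections_fiber)
  next
    case (rscale \<alpha> r)
    then show ?case
      unfolding section_rscale_def using bimodule.rs_closed[OF bimod]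
      by (intro sections_restrict) (metis fiber_group_simps(1) sections_fiber)
  qed
qed

text \<open>A partition of unity for a section with compact support, phrased as an induction principle: a set \<open>S\<close>
  of sections closed under addition contains \<open>\<xi>\<close> as soon as it contains all multiples of \<open>\<xi>\<close> by
  functions with sufficiently small support. If the bump functions \<open>f\<^sub>1, \<dots>, f\<^sub>n\<close> equal 1 on open sets
  that cover the support of \<open>\<xi>\<close>, then the product of all \<open>1 - f\<^sub>i\<close> annihilates \<open>\<xi>\<close>, and expanding it one
  factor at a time writes \<open>\<xi>\<close> as a sum of multiples \<open>(f\<^sub>i g) \<xi>\<close>. The scalar function has to remain
  visible in the last hypothesis, because the neighbourhood \<open>U\<close> may depend on \<open>\<xi>\<close>.\<close>

lemma Cc_sections_partition_of_unity:
  fixes P :: "('r::topological_unital_ring, 'a, 'v, 'g, 'w) rbundle"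
  defines "X \<equiv> arrow_space (base P)"
  assumes bimod: "\<And>\<gamma>. \<gamma> \<in> arrows (base P) \<Longrightarrow> bimodule (fiber_group P \<gamma>) (flscale P) (frscale P)"
    and bump: "bump_space TYPE('r) X"
    and V: "openin X V" "Hausdorff_space (subtopology X V)"
    and \<xi>: "\<xi> \<in> Cc_sections P V"
    and S: "S \<subseteq> sections P" "section_zero P \<in> S"
      "\<And>\<alpha> \<beta>. \<alpha> \<in> S \<Longrightarrow> \<beta> \<in> S \<Longrightarrow> section_add P \<alpha> \<beta> \<in> S"
    and local: "\<And>x. x \<in> V \<Longrightarrow> \<exists>U. openin X U \<and> x \<in> U \<and> U \<subseteq> V \<and>
        (\<forall>f C. continuous_map (subtopology X V) euclidean f \<longrightarrow> compactin X C \<longrightarrow> C \<subseteq> U \<longrightarrow>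
           (\<forall>y. y \<notin> C \<longrightarrow> f y = 0) \<longrightarrow> scale_section P f \<xi> \<in> S)"
  shows "\<xi> \<in> S"
proof -
  have \<xi>_sec: "\<xi> \<in> sections P" using \<xi> by (simp add: Cc_sections_def)
  \<comment> \<open>The open sets on which some admissible bump function is constantly 1; multiplying that function by an arbitrary \<open>g\<close> does not enlarge its support.\<close>
  define \<O> where "\<O> = {A. openin X A \<and> (\<exists>f :: 'g \<Rightarrow> 'r. continuous_map (subtopology X V) euclidean f \<and>
      (\<forall>y\<in>A. f y = 1) \<and>
      (\<forall>g. continuous_map (subtopology X V) euclidean g \<longrightarrow> scale_section P (\<lambda>y. f y * g y) \<xi> \<in> S))}"
  have "V \<subseteq> \<Union>\<O>"
  proof
    fix x assume x: "x \<in> V"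
    obtain U where U: "openin X U" "x \<in> U" "U \<subseteq> V"
      and sc: "\<And>f C. continuous_map (subtopology X V) euclidean f \<Longrightarrow> compactin X C \<Longrightarrow> C \<subseteq> U \<Longrightarrow>
           (\<forall>y. y \<notin> C \<longrightarrow> f y = 0) \<Longrightarrow> scale_section P f \<xi> \<in> S"
      using local[OF x] by blast
    obtain A C and f :: "'g \<Rightarrow> 'r" where
      f: "openin X A" "x \<in> A" "compactin X C" "C \<subseteq> U" "continuous_map (subtopology X V) euclidean f"
        "\<And>y. y \<in> A \<Longrightarrow> f y = 1" "\<And>y. y \<notin> C \<Longrightarrow> f y = 0"
      by (rule bump_in_Hausdorff_open[OF bump V U]) auto
    have "A \<in> \<O>"
      unfolding \<O>_def using f
      by (auto intro!: exI[of _ f] sc[of _ C] continuous_map_times)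
    then show "x \<in> \<Union>\<O>" using f(2) by blast
  qed
  obtain K where K: "compactin X K" "K \<subseteq> V" "\<And>\<gamma>. \<gamma> \<in> arrows (base P) - K \<Longrightarrow> \<xi> \<gamma> = fzero P \<gamma>"
    using Cc_sections_compact[OF \<xi>] unfolding X_def by blast
  have "\<exists>\<F>. finite \<F> \<and> \<F> \<subseteq> \<O> \<and> K \<subseteq> \<Union>\<F>"
    using K \<open>V \<subseteq> \<Union>\<O>\<close> by (intro compactinD[OF K(1)]) (auto simp: \<O>_def)
  then obtain \<F> where \<F>: "finite \<F>" "\<F> \<subseteq> \<O>" "K \<subseteq> \<Union>\<F>" by blast
  \<comment> \<open>The remainder \<open>g\<close> is the product of the factors \<open>1 - f\<close> used so far.\<close>
  have "\<exists>g \<sigma>. continuous_map (subtopology X V) euclidean g \<and> (\<forall>y\<in>\<Union>\<F>. g y = 0) \<and> \<sigma> \<in> S \<and>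
      \<xi> = section_add P \<sigma> (scale_section P g \<xi>)"
    using \<F>(1,2)
  proof (induction \<F>)
    case empty
    have "\<xi> = section_add P (section_zero P) (scale_section P (\<lambda>_. 1) \<xi>)"
    proof (rule ext)
      fix \<gamma>
      show "\<xi> \<gamma> = section_add P (section_zero P) (scale_section P (\<lambda>_. 1) \<xi>) \<gamma>"
      proof (cases "\<gamma> \<in> arrows (base P)")
        case True
        interpret bimodule "fiber_group P \<gamma>" "flscale P" "frscale P" by (rule bimod[OF True])
        show ?thesis
          using sections_fiber[OF \<xi>_sec True] True l_one[of "\<xi> \<gamma>"] ls_one[of "\<xi> \<gamma>"]
          by (simp add: section_add_def section_zero_def scale_section_def)
      next
        case False
        then show ?thesis using sections_undefined[OF \<xi>_sec False] by (simp add: section_add_def)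
      qed
    qed
    then show ?case using S(2) by (intro exI[of _ "\<lambda>_. 1"] exI[of _ "section_zero P"]) auto
  next
    case (insert A \<F>)
    then have "\<exists>g \<sigma>. continuous_map (subtopology X V) euclidean g \<and> (\<forall>y\<in>\<Union>\<F>. g y = 0) \<and> \<sigma> \<in> S \<and>
      \<xi> = section_add P \<sigma> (scale_section P g \<xi>)" by simp
    then obtain g \<sigma> where g: "continuous_map (subtopology X V) euclidean g" "\<And>y. y\<in>\<Union>\<F> \<Longrightarrow> g y = 0"
        "\<sigma> \<in> S" "\<xi> = section_add P \<sigma> (scale_section P g \<xi>)"
      by blast
    from insert.prems obtain f :: "'g \<Rightarrow> 'r" where f: "continuous_map (subtopology X V) euclidean f"
        "\<And>y. y \<in> A \<Longrightarrow> f y = 1"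
        "\<And>g. continuous_map (subtopology X V) euclidean g \<Longrightarrow> scale_section P (\<lambda>y. f y * g y) \<xi> \<in> S"
      by (auto simp: \<O>_def)
    define g' where "g' = (\<lambda>y. (1 - f y) * g y)"
    define \<sigma>' where "\<sigma>' = section_add P \<sigma> (scale_section P (\<lambda>y. f y * g y) \<xi>)"
    have "\<xi> = section_add P \<sigma>' (scale_section P g' \<xi>)"
    proof (rule ext)
      fix \<gamma>
      show "\<xi> \<gamma> = section_add P \<sigma>' (scale_section P g' \<xi>) \<gamma>"
      proof (cases "\<gamma> \<in> arrows (base P)")
        case True
        interpret bimodule "fiber_group P \<gamma>" "flscale P" "frscale P" by (rule bimod[OF True])
        have mem: "\<xi> \<gamma> \<in> fiber P \<gamma>" "\<sigma> \<gamma> \<in> fiber P \<gamma>"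
          using True \<xi>_sec g(3) S(1) by (auto intro: sections_fiber)
        have "\<xi> \<gamma> = fadd P (\<sigma> \<gamma>) (flscale P (g \<gamma>) (\<xi> \<gamma>))"
          using fun_cong[OF g(4), of \<gamma>] True by (simp add: section_add_def scale_section_def)
        also have "g \<gamma> = f \<gamma> * g \<gamma> + g' \<gamma>"
          by (simp add: g'_def algebra_simps)
        also have "flscale P (f \<gamma> * g \<gamma> + g' \<gamma>) (\<xi> \<gamma>) =
            fadd P (flscale P (f \<gamma> * g \<gamma>) (\<xi> \<gamma>)) (flscale P (g' \<gamma>) (\<xi> \<gamma>))"
          using ls_add_scalar mem by simp
        also have "fadd P (\<sigma> \<gamma>) \<dots> = fadd P (\<sigma>' \<gamma>) (flscale P (g' \<gamma>) (\<xi> \<gamma>))"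
          using m_assoc[of "\<sigma> \<gamma>" "flscale P (f \<gamma> * g \<gamma>) (\<xi> \<gamma>)" "flscale P (g' \<gamma>) (\<xi> \<gamma>)"]
            mem ls_closed[of "\<xi> \<gamma>"] True
          by (simp add: \<sigma>'_def section_add_def scale_section_def)
        finally show ?thesis using True by (simp add: section_add_def scale_section_def)
      next
        case False
        then show ?thesis using sections_undefined[OF \<xi>_sec False] by (simp add: section_add_def)
      qed
    qed
    moreover have "\<sigma>' \<in> S" using S(3) g f by (simp add: \<sigma>'_def)
    moreover have "continuous_map (subtopology X V) euclidean g'"
      unfolding g'_def using g f by (intro continuous_map_times continuous_map_one_minus)
    moreover have "\<forall>y\<in>\<Union>(insert A \<F>). g' y = 0"
    proof
      fix y assume "y \<in> \<Union>(insert A \<F>)"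
      then have "f y = 1 \<or> g y = 0" using f(2) g(2) by blast
      then show "g' y = 0" by (auto simp: g'_def)
    qed
    ultimately show ?case by blast
  qed
  then obtain g \<sigma> where g: "\<And>y. y\<in>\<Union>\<F> \<Longrightarrow> g y = 0" "\<sigma> \<in> S" "\<xi> = section_add P \<sigma> (scale_section P g \<xi>)"
    by blast
  have "\<xi> = \<sigma>"
  proof (rule sections_eqI[OF \<xi>_sec])
    show "\<sigma> \<in> sections P" using S(1) g(2) by blast
    fix \<gamma> assume \<gamma>: "\<gamma> \<in> arrows (base P)"
    interpret bimodule "fiber_group P \<gamma>" "flscale P" "frscale P" by (rule bimod[OF \<gamma>])
    have mem: "\<xi> \<gamma> \<in> fiber P \<gamma>" "\<sigma> \<gamma> \<in> fiber P \<gamma>"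
      using \<gamma> \<xi>_sec g(2) S(1) by (auto intro: sections_fiber)
    have "flscale P (g \<gamma>) (\<xi> \<gamma>) = fzero P \<gamma>"
    proof (cases "\<gamma> \<in> K")
      case True
      then have "g \<gamma> = 0" using g(1) \<F>(3) by blast
      then show ?thesis using ls_zero[of "\<xi> \<gamma>"] mem by simp
    next
      case False
      then show ?thesis using K(3)[of \<gamma>] \<gamma> ls_unit by simp
    qed
    moreover have "\<xi> \<gamma> = fadd P (\<sigma> \<gamma>) (flscale P (g \<gamma>) (\<xi> \<gamma>))"
      using fun_cong[OF g(3), of \<gamma>] \<gamma> by (simp add: section_add_def scale_section_def)
    ultimately show "\<xi> \<gamma> = \<sigma> \<gamma>"
      using mem r_one[of "\<sigma> \<gamma>"] by (metis fiber_group_simps)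
  qed
  then show ?thesis using g(2) by simp
qed

text \<open>With \<open>h\<close> the source or the range map this bounds the pairs that occur in a convolution, and with \<open>h\<close> the
  quotient map it bounds the terms of a sum over one class.\<close>

lemma sectional_carrier_finite_support:
  assumes bimod: "\<And>\<gamma>. \<gamma> \<in> arrows (base P) \<Longrightarrow> bimodule (fiber_group P \<gamma>) (flscale P) (frscale P)"
    and inj: "\<And>\<gamma>. \<gamma> \<in> arrows (base P) \<Longrightarrow> \<exists>U. openin (arrow_space (base P)) U \<and> \<gamma> \<in> U \<and> inj_on h U"
    and "\<alpha> \<in> sectional_carrier P"
  shows "finite {\<gamma> \<in> arrows (base P). h \<gamma> = v \<and> \<alpha> \<gamma> \<noteq> fzero P \<gamma>}"
  using assms(3)
proof induction
  case (generator V \<alpha>)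
  obtain K where K: "compactin (arrow_space (base P)) K" "K \<subseteq> V"
    "\<And>\<gamma>. \<gamma> \<in> arrows (base P) - K \<Longrightarrow> \<alpha> \<gamma> = fzero P \<gamma>"
    by (rule Cc_sections_compact[OF generator(3)]) auto
  show ?case
    by (rule finite_subset[OF _ finite_compact_Int_vimage[OF K(1) inj, where v = v]]) (use K(3) in auto)
next
  case zero
  then show ?case by (simp add: section_zero_def cong: conj_cong)
next
  case (add \<alpha> \<beta>)
  have "fadd P (fzero P \<gamma>) (fzero P \<gamma>) = fzero P \<gamma>" if "\<gamma> \<in> arrows (base P)" for \<gamma>
  proof -
    interpret bimodule "fiber_group P \<gamma>" "flscale P" "frscale P" by (rule bimod[OF that])
    show ?thesis using l_one[OF one_closed] by simp
  qed
  then have "{\<gamma> \<in> arrows (base P). h \<gamma> = v \<and> section_add P \<alpha> \<beta> \<gamma> \<noteq> fzero P \<gamma>} \<subseteq>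
      {\<gamma> \<in> arrows (base P). h \<gamma> = v \<and> \<alpha> \<gamma> \<noteq> fzero P \<gamma>} \<union> {\<gamma> \<in> arrows (base P). h \<gamma> = v \<and> \<beta> \<gamma> \<noteq> fzero P \<gamma>}"
    by (auto simp: section_add_def)
  then show ?case by (rule finite_subset) (simp add: add)
next
  case (lscale \<alpha> r)
  have "flscale P r (fzero P \<gamma>) = fzero P \<gamma>" if "\<gamma> \<in> arrows (base P)" for \<gamma>
    using bimodule.ls_unit[OF bimod[OF that]] by simp
  then show ?case
    by (intro finite_subset[OF _ lscale.IH]) (auto simp: section_lscale_def)
next
  case (rscale \<alpha> r)
  have "frscale P (fzero P \<gamma>) r = fzero P \<gamma>" if "\<gamma> \<in> arrows (base P)" for \<gamma>
    using bimodule.rs_unit[OF bimod[OF that]] by simp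
  then show ?case
    by (intro finite_subset[OF _ rscale.IH]) (auto simp: section_rscale_def)
qed

section \<open>Quotients of semigroupoids and of bundles\<close>

lemma quotient_projection:
  assumes "open_equiv X E"
  shows "continuous_map X (quotient_topology X E) (\<lambda>x. E `` {x})" 
    and "open_map X (quotient_topology X E) (\<lambda>x. E `` {x})"
    and "(\<lambda>x. E `` {x}) ` topspace X = topspace (quotient_topology X E)"
proof -
  have E: "equiv (topspace X) E" using assms by (simp add: open_equiv_def)
  show "continuous_map X (quotient_topology X E) (\<lambda>x. E `` {x})"
    by (auto simp: continuous_map_def openin_quotient_topology quotientI)
  show "open_map X (quotient_topology X E) (\<lambda>x. E `` {x})"
    unfolding open_map_def
  proof (intro allI impI)
    fix U assume U: "openin X U"
    then have "U \<subseteq> topspace X" by (rule openin_subset)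
    have "{x \<in> topspace X. E `` {x} \<in> (\<lambda>x. E `` {x}) ` U} = E `` U"
    proof (intro equalityI subsetI)
      fix x assume "x \<in> {x \<in> topspace X. E `` {x} \<in> (\<lambda>x. E `` {x}) ` U}"
      then obtain u where u: "u \<in> U" "E `` {x} = E `` {u}" "x \<in> topspace X" by auto
      then have "(u, x) \<in> E" using eq_equiv_class[OF u(2)[symmetric] E] by simp
      then show "x \<in> E `` U" using u(1) by (rule ImageI)
    next
      fix x assume "x \<in> E `` U"
      then obtain u where u: "u \<in> U" "(u, x) \<in> E" by (rule ImageE)
      then have "E `` {x} = E `` {u}" using equiv_class_eq[OF E] by metis
      then show "x \<in> {x \<in> topspace X. E `` {x} \<in> (\<lambda>x. E `` {x}) ` U}"
        using u equiv_type[OF E] by auto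
    qed
    moreover have "(\<lambda>x. E `` {x}) ` U \<subseteq> topspace X // E"
      using \<open>U \<subseteq> topspace X\<close> by (auto intro: quotientI)
    ultimately show "openin (quotient_topology X E) ((\<lambda>x. E `` {x}) ` U)"
      using assms U by (simp add: openin_quotient_topology open_equiv_def)
  qed
  show "(\<lambda>x. E `` {x}) ` topspace X = topspace (quotient_topology X E)"
    by (simp add: quotient_def image_def) blast
qed

lemma UN_class_eq:
  assumes "(x, x) \<in> E" "\<And>y. (x, y) \<in> E \<Longrightarrow> f y = f x"
  shows "(\<Union>y\<in>E `` {x}. f y) = f x"
proof -
  have "(\<Union>y\<in>E `` {x}. f y) = (\<Union>y\<in>E `` {x}. f x)"
    using assms(2) by (intro SUP_cong refl) blast
  then show ?thesis using assms(1) by blast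
qed

lemma the_elem_class_eq:
  assumes "(x, x) \<in> E" "\<And>y. (x, y) \<in> E \<Longrightarrow> f y = f x"
  shows "the_elem (f ` (E `` {x})) = f x"
proof -
  have "f ` (E `` {x}) = (\<lambda>y. f x) ` (E `` {x})"
    using assms(2) by (intro image_cong refl) blast
  also have "\<dots> = {f x}" using assms(1) by blast
  finally show ?thesis by simp
qed

lemma arrow_space_quotient [simp]: "arrow_space (quotient_sgpd G E) = quotient_topology (arrow_space G) E"
  by (simp add: quotient_sgpd_def)

text \<open>Rigidity makes source and range constant on classes, so composability can be tested on
  arbitrary representatives.\<close>

lemma rigid_congruence_quotient:
  assumes "semigroupoid G" "rigid_congruence G E"
  shows "a \<in> arrows G \<Longrightarrow> src (quotient_sgpd G E) (E `` {a}) = src G a"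
    and "a \<in> arrows G \<Longrightarrow> rng (quotient_sgpd G E) (E `` {a}) = rng G a"
    and "(a, b) \<in> composable G \<Longrightarrow> prd (quotient_sgpd G E) (E `` {a}) (E `` {b}) = E `` {prd G a b}"
    and "a \<in> arrows G \<Longrightarrow> b \<in> arrows G \<Longrightarrow>
      (E `` {a}, E `` {b}) \<in> composable (quotient_sgpd G E) \<longleftrightarrow> (a, b) \<in> composable G"
proof -
  interpret semigroupoid G by fact
  have E: "equiv (arrows G) E" 
    and sr: "\<And>x y. (x, y) \<in> E \<Longrightarrow> src G x = src G y \<and> rng G x = rng G y"
    and pr: "\<And>x1 y1 x2 y2. (x1, y1) \<in> E \<Longrightarrow> (x2, y2) \<in> E \<Longrightarrow> src G x1 = rng G x2 \<Longrightarrow>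
        (prd G x1 x2, prd G y1 y2) \<in> E"
    using assms(2) by (auto simp: rigid_congruence_def)
  have refl: "(a, a) \<in> E" if "a \<in> arrows G" for a
    using E that by (simp add: equiv_def refl_on_def)
  show src: "src (quotient_sgpd G E) (E `` {a}) = src G a" if "a \<in> arrows G" for a
    unfolding quotient_sgpd_def sgpd.simps using refl[OF that] by (rule the_elem_class_eq) (metis sr)
  show rng: "rng (quotient_sgpd G E) (E `` {a}) = rng G a" if "a \<in> arrows G" for a
    unfolding quotient_sgpd_def sgpd.simps using refl[OF that] by (rule the_elem_class_eq) (metis sr)
  show "prd (quotient_sgpd G E) (E `` {a}) (E `` {b}) = E `` {prd G a b}"
    if ab: "(a, b) \<in> composable G" for a b
  proof -
    have ab': "a \<in> arrows G" "b \<in> arrows G" "src G a = rng G b"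
      using ab by (auto simp: composable_def)
    have *: "E `` {prd G a' b'} = E `` {prd G a b}" if "a' \<in> E `` {a}" "b' \<in> E `` {b}" for a' b'
    proof -
      have "(prd G a b, prd G a' b') \<in> E" using that ab'(3) by (intro pr) auto
      then show ?thesis using equiv_class_eq[OF E] by metis
    qed
    have "prd (quotient_sgpd G E) (E `` {a}) (E `` {b}) =
        (\<Union>a'\<in>E `` {a}. \<Union>b'\<in>E `` {b}. E `` {prd G a b})"
      unfolding quotient_sgpd_def sgpd.simps by (intro SUP_cong HOL.refl *)
    then show ?thesis
      using refl[OF ab'(1)] refl[OF ab'(2)] by auto
  qed
  show "(E `` {a}, E `` {b}) \<in> composable (quotient_sgpd G E) \<longleftrightarrow> (a, b) \<in> composable G"
    if "a \<in> arrows G" "b \<in> arrows G" for a b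
  proof -
    have "E `` {a} \<in> arrows (quotient_sgpd G E)" "E `` {b} \<in> arrows (quotient_sgpd G E)"
      using that by (auto simp: quotient_sgpd_def quotientI)
    then show ?thesis
      using that src[OF that(1)] rng[OF that(2)] by (auto simp: composable_def)
  qed
qed

locale etale_bundle_quotient = continuous_R_bundle P + bundle_congruence P EG EL
  for P :: "('r::topological_unital_ring, 'a, 'v, 'g, 'w) rbundle"
    and EG :: "('g \<times> 'g) set" and EL :: "('a \<times> 'a) set" +
  assumes etale: "etale_semigroupoid (base P)"
    and normal: "locally_ring_normal_space TYPE('r) (arrow_space (base P))"
begin

abbreviation X where "X \<equiv> arrow_space (base P)"
abbreviation L where "L \<equiv> arrow_space (total P)"
abbreviation Q where "Q \<equiv> quotient_bundle P EG EL"
abbreviation q where "q \<gamma> \<equiv> EG `` {\<gamma>}"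
abbreviation p where "p x \<equiv> EL `` {x}"
abbreviation T where "T \<equiv> quotient_sum_map P EG EL"

lemma base_Q [simp]: "base Q = quotient_sgpd (base P) EG"
  and total_Q [simp]: "total Q = quotient_sgpd (total P) EL"
  by (simp_all add: quotient_bundle_def)

lemma equiv_base: "equiv (arrows (base P)) EG"
  and equiv_total: "equiv (arrows (total P)) EL"
  and open_equiv_base: "open_equiv X EG"
  and open_equiv_total: "open_equiv L EL"
  using base_congruence total_congruence
  by (auto simp: open_rigid_congruence_def rigid_congruence_def)

lemmas q_quotient = quotient_projection[OF open_equiv_base]
lemmas p_quotient = quotient_projection[OF open_equiv_total]

lemma rigid: "rigid_congruence (base P) EG" "rigid_congruence (total P) EL"
  using base_congruence total_congruence by (auto simp: open_rigid_congruence_def)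

lemmas Q_base = rigid_congruence_quotient[OF base.semigroupoid_axioms rigid(1)]
lemmas Q_total = rigid_congruence_quotient[OF total.semigroupoid_axioms rigid(2)]

lemma fiberD: "x \<in> fiber P \<gamma> \<Longrightarrow> x \<in> arrows (total P)" "x \<in> fiber P \<gamma> \<Longrightarrow> proj P x = \<gamma>"
  by (auto simp: fiber_def)

lemma proj_arrow: "x \<in> arrows (total P) \<Longrightarrow> proj P x \<in> arrows (base P)"
  using proj_rigid_hom by (auto simp: rigid_hom_def sgpd_hom_def)

lemma q_eq: "(\<gamma>, \<delta>) \<in> EG \<Longrightarrow> q \<gamma> = q \<delta>"
  using equiv_class_eq[OF equiv_base] .

lemma p_eq: "(x, y) \<in> EL \<Longrightarrow> p x = p y"
  using equiv_class_eq[OF equiv_total] .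

lemma q_eqD: "q \<gamma> = q \<delta> \<Longrightarrow> \<delta> \<in> arrows (base P) \<Longrightarrow> (\<gamma>, \<delta>) \<in> EG"
  using eq_equiv_class[OF _ equiv_base] by blast

lemma EG_refl: "\<gamma> \<in> arrows (base P) \<Longrightarrow> (\<gamma>, \<gamma>) \<in> EG"
  using equiv_base by (simp add: equiv_def refl_on_def)

lemma EL_refl: "x \<in> arrows (total P) \<Longrightarrow> (x, x) \<in> EL"
  using equiv_total by (simp add: equiv_def refl_on_def)

lemma EG_arrows: "(\<gamma>, \<delta>) \<in> EG \<Longrightarrow> \<gamma> \<in> arrows (base P) \<and> \<delta> \<in> arrows (base P)"
  using equiv_type[OF equiv_base] by blast

lemma EL_arrows: "(x, y) \<in> EL \<Longrightarrow> x \<in> arrows (total P) \<and> y \<in> arrows (total P)"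
  using equiv_type[OF equiv_total] by blast

lemma class_arrow:
  assumes "c \<in> arrows (base P) // EG" "\<gamma> \<in> c"
  shows "\<gamma> \<in> arrows (base P)" "c = q \<gamma>"
proof -
  obtain \<delta> where \<delta>: "c = q \<delta>" "\<delta> \<in> arrows (base P)" using assms(1) by (rule quotientE)
  then have "(\<delta>, \<gamma>) \<in> EG" using assms(2) by simp
  then show "\<gamma> \<in> arrows (base P)" "c = q \<gamma>" using EG_arrows q_eq \<delta>(1) by auto
qed

lemma fiber_zero: "\<gamma> \<in> arrows (base P) \<Longrightarrow> fzero P \<gamma> \<in> fiber P \<gamma>"
  using bimodule.axioms(1)[OF fiber_bimodule] by (metis comm_groupE(2) fiber_group_simps(1,3))

lemma fiber_add: "\<gamma> \<in> arrows (base P) \<Longrightarrow> x \<in> fiber P \<gamma> \<Longrightarrow> y \<in> fiber P \<gamma> \<Longrightarrow> fadd P x y \<in> fiber P \<gamma>"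
  using bimodule.axioms(1)[OF fiber_bimodule] by (metis comm_groupE(1) fiber_group_simps(1,2))

lemma fiber_lscale: "\<gamma> \<in> arrows (base P) \<Longrightarrow> x \<in> fiber P \<gamma> \<Longrightarrow> flscale P r x \<in> fiber P \<gamma>"
  using bimodule.ls_closed[OF fiber_bimodule] by (metis fiber_group_simps(1))

lemma fiber_rscale: "\<gamma> \<in> arrows (base P) \<Longrightarrow> x \<in> fiber P \<gamma> \<Longrightarrow> frscale P x r \<in> fiber P \<gamma>"
  using bimodule.rs_closed[OF fiber_bimodule] by (metis fiber_group_simps(1))

text \<open>The lifting axiom of a bundle congruence moves the zero over \<open>\<delta>\<close> to an equivalent element \<open>y\<close> over \<open>\<gamma>\<close>, and multiplying by the scalar 0 turns \<open>y\<close> into the zero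
  over \<open>\<gamma>\<close>.\<close>

lemma fzero_cong:
  assumes "(\<gamma>, \<delta>) \<in> EG"
  shows "(fzero P \<gamma>, fzero P \<delta>) \<in> EL"
proof -
  have \<gamma>\<delta>: "\<gamma> \<in> arrows (base P)" "\<delta> \<in> arrows (base P)" using EG_arrows assms by auto
  note z = fiberD[OF fiber_zero[OF \<gamma>\<delta>(1)]] fiberD[OF fiber_zero[OF \<gamma>\<delta>(2)]]
  obtain y where y: "(fzero P \<delta>, y) \<in> EL" "\<gamma> = proj P y"
    using fiber_lift[of "fzero P \<gamma>" "fzero P \<delta>"] z assms by auto
  have "y \<in> fiber P \<gamma>" using y EL_arrows by (auto simp: fiber_def)
  then have "flscale P 0 y = fzero P \<gamma>"
    using bimodule.ls_zero[OF fiber_bimodule[OF \<gamma>\<delta>(1)]] by simp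
  moreover have "flscale P 0 (fzero P \<delta>) = fzero P \<delta>"
    using bimodule.ls_zero[OF fiber_bimodule[OF \<gamma>\<delta>(2)]] fiber_zero[OF \<gamma>\<delta>(2)] by simp
  ultimately have "(fzero P \<delta>, fzero P \<gamma>) \<in> EL" using flscale_cong[OF y(1), of 0] by simp
  then show ?thesis using equiv_total by (meson equiv_def symD)
qed

lemma fzero_Q: "\<gamma> \<in> arrows (base P) \<Longrightarrow> fzero Q (q \<gamma>) = p (fzero P \<gamma>)"
  unfolding quotient_bundle_def rbundle.simps
  by (rule UN_class_eq) (simp add: EG_refl, rule p_eq[symmetric], rule fzero_cong)

lemma proj_Q: "x \<in> arrows (total P) \<Longrightarrow> proj Q (p x) = q (proj P x)"
  unfolding quotient_bundle_def rbundle.simps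
  by (rule UN_class_eq) (simp add: EL_refl, rule q_eq[symmetric], rule proj_cong)

lemma flscale_Q: "x \<in> arrows (total P) \<Longrightarrow> flscale Q r (p x) = p (flscale P r x)"
  unfolding quotient_bundle_def rbundle.simps
  by (rule UN_class_eq) (simp add: EL_refl, rule p_eq[symmetric], rule flscale_cong)

lemma frscale_Q: "x \<in> arrows (total P) \<Longrightarrow> frscale Q (p x) r = p (frscale P x r)"
  unfolding quotient_bundle_def rbundle.simps
  by (rule UN_class_eq) (simp add: EL_refl, rule p_eq[symmetric], rule frscale_cong)

lemma fadd_Q:
  assumes "x \<in> arrows (total P)" "y \<in> arrows (total P)" "proj P x = proj P y"
  shows "fadd Q (p x) (p y) = p (fadd P x y)"
proof -
  have *: "p (fadd P x' y') = p (fadd P x y)"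
    if "x' \<in> p x" "y' \<in> {y' \<in> p y. proj P y' = proj P x'}" for x' y'
  proof -
    have "(fadd P x y, fadd P x' y') \<in> EL" using that assms(3) by (intro fadd_cong) auto
    then show ?thesis using p_eq by metis
  qed
  have "fadd Q (p x) (p y) = (\<Union>x'\<in>p x. \<Union>y'\<in>{y' \<in> p y. proj P y' = proj P x'}. p (fadd P x y))"
    unfolding quotient_bundle_def rbundle.simps by (intro SUP_cong HOL.refl *)
  moreover have "x \<in> p x" "y \<in> {y' \<in> p y. proj P y' = proj P x}"
    using assms EL_refl by auto
  ultimately show ?thesis by (intro equalityI) auto
qed

lemma p_fiber:
  assumes "x \<in> fiber P \<gamma>"
  shows "p x \<in> fiber Q (q \<gamma>)"
  using fiberD[OF assms] proj_Q by (auto simp: fiber_def[of Q] quotientI)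

text \<open>All elements of a quotient fiber have representatives over one and the same arrow \<open>\<gamma>\<close>. Identities
  in the quotient fiber can therefore be checked in the fiber over \<open>\<gamma>\<close>.\<close>

lemma fiber_Q_lift:
  assumes "C \<in> fiber Q (q \<gamma>)" "\<gamma> \<in> arrows (base P)"
  obtains x where "x \<in> fiber P \<gamma>" "C = p x"
proof -
  have C: "C \<in> arrows (total P) // EL" "proj Q C = q \<gamma>"
    using assms(1) by (auto simp: fiber_def)
  then obtain y where y: "C = p y" "y \<in> arrows (total P)" by (auto elim: quotientE)
  have z: "fzero P \<gamma> \<in> arrows (total P)" "proj P (fzero P \<gamma>) = \<gamma>"
    using fiberD[OF fiber_zero[OF assms(2)]] by auto
  have "q \<gamma> = q (proj P y)" using C(2) y proj_Q by simp
  then have "(\<gamma>, proj P y) \<in> EG" using proj_arrow[OF y(2)] by (rule q_eqD)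
  then obtain y' where y': "(y, y') \<in> EL" "\<gamma> = proj P y'"
    using fiber_lift[OF z(1) y(2)] z(2) by auto
  then show ?thesis
    using p_eq[OF y'(1)] y(1) EL_arrows[OF y'(1)] by (intro that[of y']) (auto simp: fiber_def)
qed

lemma p_hom: "\<gamma> \<in> arrows (base P) \<Longrightarrow> p \<in> hom (fiber_group P \<gamma>) (fiber_group Q (q \<gamma>))"
  by (rule homI) (simp_all add: p_fiber fadd_Q fiberD)

lemma Q_bimodule:
  assumes "c \<in> arrows (base P) // EG"
  shows "bimodule (fiber_group Q c) (flscale Q) (frscale Q)"
proof -
  obtain \<gamma> where c: "c = q \<gamma>" and \<gamma>: "\<gamma> \<in> arrows (base P)" using assms by (rule quotientE)
  interpret F: bimodule "fiber_group P \<gamma>" "flscale P" "frscale P" by (rule fiber_bimodule[OF \<gamma>])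
  have lift: "\<exists>x\<in>fiber P \<gamma>. C = p x" if "C \<in> fiber Q c" for C
    using that fiber_Q_lift \<gamma> unfolding c by metis
  have cl: "p x \<in> fiber Q c" if "x \<in> fiber P \<gamma>" for x using p_fiber that c by simp
  have add: "fadd Q (p x) (p y) = p (fadd P x y)" if "x \<in> fiber P \<gamma>" "y \<in> fiber P \<gamma>" for x y
    using that fadd_Q fiberD by metis
  have ls: "flscale Q r (p x) = p (flscale P r x)" if "x \<in> fiber P \<gamma>" for x r
    using that flscale_Q fiberD by metis
  have rs: "frscale Q (p x) r = p (frscale P x r)" if "x \<in> fiber P \<gamma>" for x r
    using that frscale_Q fiberD by metis
  have zero: "fzero Q c = p (fzero P \<gamma>)" using fzero_Q \<gamma> c by simp
  note closed = F.m_closed F.one_closed F.ls_closed F.rs_closed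
  show ?thesis
  proof (intro bimodule.intro comm_groupI bimodule_axioms.intro, unfold fiber_group_simps)
    fix C D E r s assume C: "C \<in> fiber Q c" 
    from lift[OF C] obtain x where x: "x \<in> fiber P \<gamma>" "C = p x" by blast
    note [simp] = fiber_add[OF \<gamma>] fiber_zero[OF \<gamma>] fiber_lscale[OF \<gamma>] fiber_rscale[OF \<gamma>] cl add ls rs zero
    show "fadd Q (fzero Q c) C = C" using x F.l_one by simp
    show "\<exists>D\<in>fiber Q c. fadd Q D C = fzero Q c"
      using x F.l_inv[of x] F.inv_closed[of x] cl add zero by (metis fiber_group_simps)
    show "flscale Q r C \<in> fiber Q c" using x by simp
    show "frscale Q C r \<in> fiber Q c" using x by simp
    show "flscale Q (r + s) C = fadd Q (flscale Q r C) (flscale Q s C)" using x F.ls_add_scalar by simp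
    show "flscale Q (r * s) C = flscale Q r (flscale Q s C)" using x F.ls_mult_scalar by simp
    show "flscale Q 1 C = C" using x F.ls_one by simp
    show "frscale Q C (r + s) = fadd Q (frscale Q C r) (frscale Q C s)" using x F.rs_add_scalar by simp
    show "frscale Q C (r * s) = frscale Q (frscale Q C r) s" using x F.rs_mult_scalar by simp
    show "frscale Q C 1 = C" using x F.rs_one by simp
    show "frscale Q (flscale Q r C) s = flscale Q r (frscale Q C s)" using x F.ls_rs by simp
    assume D: "D \<in> fiber Q c" 
    from lift[OF D] obtain y where y: "y \<in> fiber P \<gamma>" "D = p y" by blast
    show "fadd Q C D \<in> fiber Q c" using x y by simp
    show "fadd Q C D = fadd Q D C" using x y F.m_comm by simp
    show "flscale Q r (fadd Q C D) = fadd Q (flscale Q r C) (flscale Q r D)" using x y F.ls_add by simp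
    show "frscale Q (fadd Q C D) r = fadd Q (frscale Q C r) (frscale Q D r)" using x y F.rs_add by simp
    assume E: "E \<in> fiber Q c" 
    from lift[OF E] obtain z where z: "z \<in> fiber P \<gamma>" "E = p z" by blast
    show "fadd Q (fadd Q C D) E = fadd Q C (fadd Q D E)" using x y z F.m_assoc by simp
  next
    show "fzero Q c \<in> fiber Q c" using zero cl fiber_zero[OF \<gamma>] by simp
  qed
qed

lemma prd_fiber:
  assumes "(a, b) \<in> composable (base P)" "x \<in> fiber P a" "y \<in> fiber P b"
  shows "(x, y) \<in> composable (total P)" "prd (total P) x y \<in> fiber P (prd (base P) a b)"
    "prd (total Q) (p x) (p y) = p (prd (total P) x y)"
proof -
  note x = fiberD[OF assms(2)] and y = fiberD[OF assms(3)]
  show xy: "(x, y) \<in> composable (total P)"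
    using proj_rigid_hom assms(1) x y unfolding rigid_hom_def by auto
  have "proj P (prd (total P) x y) = prd (base P) a b"
    using proj_rigid_hom xy x y unfolding rigid_hom_def sgpd_hom_def by auto
  then show "prd (total P) x y \<in> fiber P (prd (base P) a b)"
    using total.prd_closed[OF xy] by (simp add: fiber_def)
  show "prd (total Q) (p x) (p y) = p (prd (total P) x y)"
    using Q_total(3)[OF xy] by simp
qed

lemma prd_hom:
  assumes "(a, b) \<in> composable (base P)" 
  shows "x \<in> fiber P a \<Longrightarrow> prd (total P) x \<in> hom (fiber_group P b) (fiber_group P (prd (base P) a b))"
    and "y \<in> fiber P b \<Longrightarrow> (\<lambda>x. prd (total P) x y) \<in> hom (fiber_group P a) (fiber_group P (prd (base P) a b))"
  using prd_fiber(2)[OF assms] prd_add_left[OF assms] prd_add_right[OF assms] by (auto simp: hom_def)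

lemma Q_prd_hom:
  assumes "(a, b) \<in> composable (base P)"
  shows "C \<in> fiber Q (q a) \<Longrightarrow> prd (total Q) C \<in> hom (fiber_group Q (q b)) (fiber_group Q (q (prd (base P) a b)))"
    and "D \<in> fiber Q (q b) \<Longrightarrow> (\<lambda>C. prd (total Q) C D) \<in> hom (fiber_group Q (q a)) (fiber_group Q (q (prd (base P) a b)))"
proof -
  have ab: "a \<in> arrows (base P)" "b \<in> arrows (base P)" "prd (base P) a b \<in> arrows (base P)"
    using assms base.prd_closed by (auto simp: composable_def)
  have fadd_p: "fadd Q (p x) (p y) = p (fadd P x y)" if "x \<in> fiber P c" "y \<in> fiber P c" for x y c
    using that fadd_Q fiberD by metis
  show "prd (total Q) C \<in> hom (fiber_group Q (q b)) (fiber_group Q (q (prd (base P) a b)))"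
    if C: "C \<in> fiber Q (q a)"
  proof (rule homI; unfold fiber_group_simps)
    obtain x where x: "x \<in> fiber P a" "C = p x" using fiber_Q_lift[OF C ab(1)] .
    fix D assume D: "D \<in> fiber Q (q b)"
    obtain y where y: "y \<in> fiber P b" "D = p y" using fiber_Q_lift[OF D ab(2)] .
    show "prd (total Q) C D \<in> fiber Q (q (prd (base P) a b))"
      unfolding x y prd_fiber(3)[OF assms x(1) y(1)] by (intro p_fiber prd_fiber(2)[OF assms] x y)
    fix E assume E: "E \<in> fiber Q (q b)"
    obtain z where z: "z \<in> fiber P b" "E = p z" using fiber_Q_lift[OF E ab(2)] .
    show "prd (total Q) C (fadd Q D E) = fadd Q (prd (total Q) C D) (prd (total Q) C E)"
      unfolding x y z fadd_p[OF y(1) z(1)] prd_fiber(3)[OF assms x(1) y(1)] prd_fiber(3)[OF assms x(1) z(1)]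
        prd_fiber(3)[OF assms x(1) fiber_add[OF ab(2) y(1) z(1)]] prd_add_right[OF assms x(1) y(1) z(1)]
      by (rule fadd_p[of _ "prd (base P) a b", symmetric]) (intro prd_fiber(2)[OF assms] x y z)+
  qed
  show "(\<lambda>C. prd (total Q) C D) \<in> hom (fiber_group Q (q a)) (fiber_group Q (q (prd (base P) a b)))"
    if D: "D \<in> fiber Q (q b)"
  proof (rule homI; unfold fiber_group_simps)
    obtain y where y: "y \<in> fiber P b" "D = p y" using fiber_Q_lift[OF D ab(2)] .
    fix C assume C: "C \<in> fiber Q (q a)"
    obtain x where x: "x \<in> fiber P a" "C = p x" using fiber_Q_lift[OF C ab(1)] .
    show "prd (total Q) C D \<in> fiber Q (q (prd (base P) a b))"
      unfolding x y prd_fiber(3)[OF assms x(1) y(1)] by (intro p_fiber prd_fiber(2)[OF assms] x y)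
    fix E assume E: "E \<in> fiber Q (q a)"
    obtain z where z: "z \<in> fiber P a" "E = p z" using fiber_Q_lift[OF E ab(1)] .
    show "prd (total Q) (fadd Q C E) D = fadd Q (prd (total Q) C D) (prd (total Q) E D)"
      unfolding x y z fadd_p[OF x(1) z(1)] prd_fiber(3)[OF assms x(1) y(1)] prd_fiber(3)[OF assms z(1) y(1)]
        prd_fiber(3)[OF assms fiber_add[OF ab(1) x(1) z(1)] y(1)] prd_add_left[OF assms x(1) z(1) y(1)]
      by (rule fadd_p[of _ "prd (base P) a b", symmetric]) (intro prd_fiber(2)[OF assms] x y z)+
  qed
qed

lemma locally_injective_src: "\<gamma> \<in> arrows (base P) \<Longrightarrow> \<exists>U. openin X U \<and> \<gamma> \<in> U \<and> inj_on (src (base P)) U"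
  using local_homeomorphism_inj etale_semigroupoid.local_homeo_src[OF etale] by metis

lemma locally_injective_rng: "\<gamma> \<in> arrows (base P) \<Longrightarrow> \<exists>U. openin X U \<and> \<gamma> \<in> U \<and> inj_on (rng (base P)) U"
  using local_homeomorphism_inj etale_semigroupoid.local_homeo_rng[OF etale] by metis

lemma EG_src: "(\<gamma>, \<delta>) \<in> EG \<Longrightarrow> src (base P) \<gamma> = src (base P) \<delta>"
  and EG_rng: "(\<gamma>, \<delta>) \<in> EG \<Longrightarrow> rng (base P) \<gamma> = rng (base P) \<delta>"
  using rigid(1) by (auto simp: rigid_congruence_def)

text \<open>Equivalent arrows have the same source.\<close>

lemma inj_on_q_if_inj_on_src: "inj_on (src (base P)) U \<Longrightarrow> U \<subseteq> arrows (base P) \<Longrightarrow> inj_on (\<lambda>\<gamma>. q \<gamma>) U"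
  unfolding inj_on_def by (metis EG_src q_eqD subsetD)

lemma locally_injective_q: 
  assumes "\<gamma> \<in> arrows (base P)"
  shows "\<exists>U. openin X U \<and> \<gamma> \<in> U \<and> inj_on (\<lambda>\<gamma>. q \<gamma>) U"
proof -
  obtain U where U: "openin X U" "\<gamma> \<in> U" "inj_on (src (base P)) U" using locally_injective_src[OF assms] by blast
  then show ?thesis using inj_on_q_if_inj_on_src[OF U(3) openin_subset[OF U(1)]] by blast
qed

lemma bump_space_base: "bump_space TYPE('r) X"
proof (rule bump_spaceI[OF normal])
  note e = etale_semigroupoid.local_homeo_src[OF etale]
  show "neighbourhood_base_of (compactin X) X"
    by (rule local_homeomorphism_compact_base[OF e etale_semigroupoid.vertices_locally_compact[OF etale]])
  show "\<exists>U. openin X U \<and> x \<in> U \<and> Hausdorff_space (subtopology X U)" if "x \<in> topspace X" for x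
    by (rule local_homeomorphism_Hausdorff[OF e etale_semigroupoid.vertices_Hausdorff[OF etale] that])
qed

lemma bump_space_quotient_base: "bump_space TYPE('r) (arrow_space (base Q))"
  unfolding base_Q arrow_space_quotient
  by (rule bump_space_open_image[OF bump_space_base q_quotient locally_injective_q])

lemma base_Q_arrows: "arrows (base Q) = arrows (base P) // EG"
  by simp

lemma P_carrier_sections: "sectional_carrier P \<subseteq> sections P"
  using sectional_carrier_sections[of P] fiber_bimodule by simp

lemma finite_support_class:
  assumes "\<alpha> \<in> sectional_carrier P" "c \<in> arrows (base P) // EG"
  shows "finite {\<gamma> \<in> c. \<alpha> \<gamma> \<noteq> fzero P \<gamma>}"
proof -
  have "finite {\<gamma> \<in> arrows (base P). q \<gamma> = c \<and> \<alpha> \<gamma> \<noteq> fzero P \<gamma>}"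
    using sectional_carrier_finite_support[OF fiber_bimodule locally_injective_q assms(1)] .
  then show ?thesis
    by (rule rev_finite_subset) (use class_arrow[OF assms(2)] in auto)
qed

lemma Q_comm_group: "c \<in> arrows (base P) // EG \<Longrightarrow> comm_group (fiber_group Q c)"
  using Q_bimodule bimodule.axioms(1) by blast

lemma P_comm_group: "c \<in> arrows (base P) \<Longrightarrow> comm_group (fiber_group P c)"
  using fiber_bimodule bimodule.axioms(1) by blast

lemma p_class_fiber:
  assumes "c \<in> arrows (base P) // EG" "\<gamma> \<in> c" "x \<in> fiber P \<gamma>"
  shows "p x \<in> fiber Q c"
  using p_fiber[OF assms(3)] class_arrow[OF assms(1,2)] by simp

lemma fzero_class:
  assumes "c \<in> arrows (base P) // EG" "\<gamma> \<in> c"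
  shows "p (fzero P \<gamma>) = fzero Q c"
  using fzero_Q[of \<gamma>] class_arrow[OF assms(1,2)] by metis

section \<open>Summation over classes is linear\<close>

text \<open>The working form of \<open>T\<close>: the index set may be any finite part of the class outside of which \<open>\<alpha>\<close>
  vanishes.\<close>

lemma T_eq_finprod:
  assumes c: "c \<in> arrows (base P) // EG" and F: "finite F" "F \<subseteq> c"
    and \<alpha>: "\<And>\<gamma>. \<gamma> \<in> c \<Longrightarrow> \<alpha> \<gamma> \<in> fiber P \<gamma>" "\<And>\<gamma>. \<gamma> \<in> c - F \<Longrightarrow> \<alpha> \<gamma> = fzero P \<gamma>"
  shows "T \<alpha> c = finprod (fiber_group Q c) (\<lambda>\<gamma>. p (\<alpha> \<gamma>)) F"
proof -
  have "T \<alpha> c = fiber_sum Q c (\<lambda>\<gamma>. p (\<alpha> \<gamma>)) c"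
    unfolding quotient_sum_map_def using c by simp
  also have "\<dots> = finprod (fiber_group Q c) (\<lambda>\<gamma>. p (\<alpha> \<gamma>)) F"
  proof (rule fiber_sum_eq_finprod[OF _ F])
    show "comm_monoid (fiber_group Q c)"
      using Q_comm_group[OF c] by (simp add: comm_group_def)
    show "p (\<alpha> \<gamma>) \<in> fiber Q c" if "\<gamma> \<in> F" for \<gamma>
      using that F(2) p_class_fiber[OF c] \<alpha>(1) by blast
    show "p (\<alpha> \<gamma>) = fzero Q c" if "\<gamma> \<in> c - F" for \<gamma>
      using that fzero_class[OF c] \<alpha>(2) by (metis DiffD1)
  qed
  finally show ?thesis .
qed

lemma carrier_class_fiber:
  assumes "\<alpha> \<in> sectional_carrier P" "c \<in> arrows (base P) // EG" "\<gamma> \<in> c"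
  shows "\<alpha> \<gamma> \<in> fiber P \<gamma>"
  using assms P_carrier_sections class_arrow[OF assms(2,3)] by (auto intro: sections_fiber)

lemma T_fiber:
  assumes "\<alpha> \<in> sectional_carrier P" "c \<in> arrows (base P) // EG"
  shows "T \<alpha> c \<in> fiber Q c"
proof -
  interpret comm_group "fiber_group Q c" by (rule Q_comm_group[OF assms(2)])
  let ?F = "{\<gamma> \<in> c. \<alpha> \<gamma> \<noteq> fzero P \<gamma>}"
  have "T \<alpha> c = finprod (fiber_group Q c) (\<lambda>\<gamma>. p (\<alpha> \<gamma>)) ?F"
    by (rule T_eq_finprod[OF assms(2) finite_support_class[OF assms]])
       (use carrier_class_fiber[OF assms] in auto)
  also have "\<dots> \<in> carrier (fiber_group Q c)"
    by (rule finprod_closed) (use p_class_fiber[OF assms(2)] carrier_class_fiber[OF assms] in auto)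
  finally show ?thesis by simp
qed

lemma T_sections: "\<alpha> \<in> sectional_carrier P \<Longrightarrow> T \<alpha> \<in> sections Q"
  using T_fiber[of \<alpha>] unfolding sections_def by (auto simp: PiE_def extensional_def quotient_sum_map_def)

lemma T_add:
  assumes "\<alpha> \<in> sectional_carrier P" "\<beta> \<in> sectional_carrier P"
  shows "T (section_add P \<alpha> \<beta>) = section_add Q (T \<alpha>) (T \<beta>)"
proof (rule sections_eqI)
  have sum: "section_add P \<alpha> \<beta> \<in> sectional_carrier P" using assms by (rule sectional_carrier.add)
  show "T (section_add P \<alpha> \<beta>) \<in> sections Q" using sum by (rule T_sections)
  have "comm_group (fiber_group Q c)" if "c \<in> arrows (base Q)" for c
    using Q_comm_group[of c] that by simp
  then show "section_add Q (T \<alpha>) (T \<beta>) \<in> sections Q"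
    unfolding section_add_def
    by (intro sections_restrict) (metis T_fiber assms base_Q_arrows comm_groupE(1) fiber_group_simps(1,2))
  fix c assume "c \<in> arrows (base Q)"
  then have c: "c \<in> arrows (base P) // EG" by simp
  interpret M: comm_group "fiber_group Q c" by (rule Q_comm_group[OF c])
  let ?F = "{\<gamma> \<in> c. \<alpha> \<gamma> \<noteq> fzero P \<gamma>} \<union> {\<gamma> \<in> c. \<beta> \<gamma> \<noteq> fzero P \<gamma>}"
  have F: "finite ?F" "?F \<subseteq> c" using finite_support_class assms c by auto
  have zz: "fadd P (fzero P \<gamma>) (fzero P \<gamma>) = fzero P \<gamma>" if "\<gamma> \<in> c" for \<gamma>
  proof -
    interpret comm_group "fiber_group P \<gamma>" by (rule P_comm_group[OF class_arrow(1)[OF c that]])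
    show ?thesis using l_one[OF one_closed] by simp
  qed
  have add: "section_add P \<alpha> \<beta> \<gamma> = fadd P (\<alpha> \<gamma>) (\<beta> \<gamma>)" if "\<gamma> \<in> c" for \<gamma>
    using class_arrow[OF c that] by (simp add: section_add_def)
  have p_add: "p (section_add P \<alpha> \<beta> \<gamma>) = fadd Q (p (\<alpha> \<gamma>)) (p (\<beta> \<gamma>))" if "\<gamma> \<in> c" for \<gamma>
    using add[OF that] fadd_Q[of "\<alpha> \<gamma>" "\<beta> \<gamma>"] fiberD[OF carrier_class_fiber[OF assms(1) c that]]
      fiberD[OF carrier_class_fiber[OF assms(2) c that]] by simp
  have cl: "p (\<alpha> \<gamma>) \<in> fiber Q c" "p (\<beta> \<gamma>) \<in> fiber Q c" if "\<gamma> \<in> c" for \<gamma>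
    using p_class_fiber[OF c that] carrier_class_fiber[OF assms(1) c that] carrier_class_fiber[OF assms(2) c that] by auto
  have "T (section_add P \<alpha> \<beta>) c = finprod (fiber_group Q c) (\<lambda>\<gamma>. p (section_add P \<alpha> \<beta> \<gamma>)) ?F"
    by (rule T_eq_finprod[OF c F carrier_class_fiber[OF sum c]]) (use add zz in auto)
  also have "\<dots> = finprod (fiber_group Q c) (\<lambda>\<gamma>. fadd Q (p (\<alpha> \<gamma>)) (p (\<beta> \<gamma>))) ?F"
    using p_add cl M.m_closed by (intro M.finprod_cong') auto
  also have "\<dots> = fadd Q (finprod (fiber_group Q c) (\<lambda>\<gamma>. p (\<alpha> \<gamma>)) ?F) (finprod (fiber_group Q c) (\<lambda>\<gamma>. p (\<beta> \<gamma>)) ?F)"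
    using M.finprod_multf[of "\<lambda>\<gamma>. p (\<alpha> \<gamma>)" ?F "\<lambda>\<gamma>. p (\<beta> \<gamma>)"] cl by auto
  also have "finprod (fiber_group Q c) (\<lambda>\<gamma>. p (\<alpha> \<gamma>)) ?F = T \<alpha> c"
    by (rule T_eq_finprod[OF c F carrier_class_fiber[OF assms(1) c], symmetric]) auto
  also have "finprod (fiber_group Q c) (\<lambda>\<gamma>. p (\<beta> \<gamma>)) ?F = T \<beta> c"
    by (rule T_eq_finprod[OF c F carrier_class_fiber[OF assms(2) c], symmetric]) auto
  finally show "T (section_add P \<alpha> \<beta>) c = section_add Q (T \<alpha>) (T \<beta>) c"
    using c by (simp add: section_add_def[of Q])
qed

text \<open>Left and right multiplication by a scalar are both instances: a fiberwise operation \<open>h\<close> that descends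
  to an additive map \<open>h'\<close> of the quotient fibers commutes with the summation over a class.\<close>

lemma T_fiberwise_hom:
  assumes \<alpha>: "\<alpha> \<in> sectional_carrier P" and \<beta>: "\<beta> \<in> sectional_carrier P"
    and c: "c \<in> arrows (base P) // EG"
    and hP: "\<And>\<gamma>. \<gamma> \<in> arrows (base P) \<Longrightarrow> h (fzero P \<gamma>) = fzero P \<gamma>"
    and hQ: "h' \<in> hom (fiber_group Q c) (fiber_group Q c)"
    and ph: "\<And>x. x \<in> arrows (total P) \<Longrightarrow> p (h x) = h' (p x)"
    and \<beta>_eq: "\<And>\<gamma>. \<gamma> \<in> arrows (base P) \<Longrightarrow> \<beta> \<gamma> = h (\<alpha> \<gamma>)"
  shows "T \<beta> c = h' (T \<alpha> c)"
proof -
  let ?F = "{\<gamma> \<in> c. \<alpha> \<gamma> \<noteq> fzero P \<gamma>}"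
  have F: "finite ?F" "?F \<subseteq> c" using finite_support_class \<alpha> c by auto
  note M = Q_comm_group[OF c]
  interpret M: comm_group "fiber_group Q c" by (rule M)
  note fib = carrier_class_fiber[OF \<alpha> c]
  have "T \<beta> c = finprod (fiber_group Q c) (\<lambda>\<gamma>. p (\<beta> \<gamma>)) ?F"
    by (rule T_eq_finprod[OF c F carrier_class_fiber[OF \<beta> c]]) (use class_arrow[OF c] \<beta>_eq hP in auto)
  also have "\<dots> = finprod (fiber_group Q c) (\<lambda>\<gamma>. h' (p (\<alpha> \<gamma>))) ?F"
  proof (rule M.finprod_cong')
    show "(\<lambda>\<gamma>. h' (p (\<alpha> \<gamma>))) \<in> ?F \<rightarrow> carrier (fiber_group Q c)"
      using hQ p_class_fiber[OF c] fib by (auto simp: hom_def)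
    show "p (\<beta> \<gamma>) = h' (p (\<alpha> \<gamma>))" if "\<gamma> \<in> ?F" for \<gamma>
    proof -
      have "\<gamma> \<in> c" using that by simp
      then show ?thesis using \<beta>_eq class_arrow[OF c] ph fiberD[OF fib] by simp
    qed
  qed simp
  also have "\<dots> = h' (finprod (fiber_group Q c) (\<lambda>\<gamma>. p (\<alpha> \<gamma>)) ?F)"
    using p_class_fiber[OF c] fib by (intro hom_finprod[OF M M hQ, symmetric]) auto
  also have "finprod (fiber_group Q c) (\<lambda>\<gamma>. p (\<alpha> \<gamma>)) ?F = T \<alpha> c"
    by (rule T_eq_finprod[OF c F fib, symmetric]) auto
  finally show ?thesis .
qed

lemma T_lscale:
  assumes "\<alpha> \<in> sectional_carrier P"
  shows "T (section_lscale P r \<alpha>) = section_lscale Q r (T \<alpha>)"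
proof (rule ext)
  fix c
  show "T (section_lscale P r \<alpha>) c = section_lscale Q r (T \<alpha>) c"
  proof (cases "c \<in> arrows (base P) // EG")
    case True
    interpret bimodule "fiber_group Q c" "flscale Q" "frscale Q" by (rule Q_bimodule[OF True])
    have "T (section_lscale P r \<alpha>) c = flscale Q r (T \<alpha> c)"
      using bimodule.ls_unit[OF fiber_bimodule] flscale_Q ls_hom
      by (intro T_fiberwise_hom[OF assms sectional_carrier.lscale[OF assms] True, where h = "flscale P r"])
         (auto simp: section_lscale_def)
    then show ?thesis using True by (simp add: section_lscale_def[of Q])
  qed (simp add: section_lscale_def quotient_sum_map_def)
qed

lemma T_rscale:
  assumes "\<alpha> \<in> sectional_carrier P"
  shows "T (section_rscale P \<alpha> r) = section_rscale Q (T \<alpha>) r"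
proof (rule ext)
  fix c
  show "T (section_rscale P \<alpha> r) c = section_rscale Q (T \<alpha>) r c"
  proof (cases "c \<in> arrows (base P) // EG")
    case True
    interpret bimodule "fiber_group Q c" "flscale Q" "frscale Q" by (rule Q_bimodule[OF True])
    have "T (section_rscale P \<alpha> r) c = frscale Q (T \<alpha> c) r"
      using bimodule.rs_unit[OF fiber_bimodule] frscale_Q rs_hom
      by (intro T_fiberwise_hom[OF assms sectional_carrier.rscale[OF assms] True, 
            where h = "\<lambda>x. frscale P x r" and h' = "\<lambda>x. frscale Q x r"])
         (auto simp: section_rscale_def)
    then show ?thesis using True by (simp add: section_rscale_def[of Q])
  qed (simp add: section_rscale_def quotient_sum_map_def)
qed

lemma T_zero: "T (section_zero P) = section_zero Q"
proof (rule ext)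
  fix c
  show "T (section_zero P) c = section_zero Q c"
  proof (cases "c \<in> arrows (base P) // EG")
    case True
    interpret comm_group "fiber_group Q c" by (rule Q_comm_group[OF True])
    have "T (section_zero P) c = finprod (fiber_group Q c) (\<lambda>\<gamma>. p (section_zero P \<gamma>)) {}"
      using carrier_class_fiber[OF sectional_carrier.zero True] class_arrow[OF True]
      by (intro T_eq_finprod[OF True]) (auto simp: section_zero_def)
    then show ?thesis using True by (simp add: section_zero_def)
  qed (simp add: section_zero_def quotient_sum_map_def)
qed

section \<open>Summation over classes is multiplicative\<close>

text \<open>Rigidity enters twice. All arrows of the class \<open>c\<close> have the same source \<open>v\<close> and range \<open>w\<close>, so every pair
  contributing to one of the two sides has its factors in the finite sets \<open>A0\<close> and \<open>B0\<close>. Moreover, if the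
  classes of \<open>a\<close> and \<open>b\<close> are composable, then so are \<open>a\<close> and \<open>b\<close>, hence the product of the sums over
  two classes expands into a sum over composable pairs only.\<close>

lemma T_mult:
  assumes \<alpha>: "\<alpha> \<in> sectional_carrier P" and \<beta>: "\<beta> \<in> sectional_carrier P"
  shows "T (convolution P \<alpha> \<beta>) = convolution Q (T \<alpha>) (T \<beta>)"
proof (rule ext)
  fix c
  show "T (convolution P \<alpha> \<beta>) c = convolution Q (T \<alpha>) (T \<beta>) c"
  proof (cases "c \<in> arrows (base P) // EG")
    case c: True
    obtain \<gamma>0 where \<gamma>0: "c = q \<gamma>0" "\<gamma>0 \<in> arrows (base P)" using c by (rule quotientE)
    define v w where "v = src (base P) \<gamma>0" and "w = rng (base P) \<gamma>0"
    have c_sr: "src (base P) \<gamma> = v" "rng (base P) \<gamma> = w" if "\<gamma> \<in> c" for \<gamma>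
      using that \<gamma>0 EG_src[of \<gamma>0 \<gamma>] EG_rng[of \<gamma>0 \<gamma>] by (auto simp: v_def w_def)
    define A0 where "A0 = {a \<in> arrows (base P). rng (base P) a = w \<and> \<alpha> a \<noteq> fzero P a}"
    define B0 where "B0 = {b \<in> arrows (base P). src (base P) b = v \<and> \<beta> b \<noteq> fzero P b}"
    have fin: "finite A0" "finite B0"
      using sectional_carrier_finite_support[OF fiber_bimodule locally_injective_rng \<alpha>]
        sectional_carrier_finite_support[OF fiber_bimodule locally_injective_src \<beta>] by (auto simp: A0_def B0_def)
    define m where "m = (\<lambda>(a, b). prd (base P) a b)"
    define t where "t = (\<lambda>(a, b). prd (total P) (\<alpha> a) (\<beta> b))"
    \<comment> \<open>The left-hand side groups the pairs in the set \<open>S\<close> below along \<open>m\<close>, the right-hand side along \<open>h\<close>.\<close>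
    define h where "h = (\<lambda>(a, b). (q a, q b))"
    define S where "S = {z \<in> A0 \<times> B0. z \<in> composable (base P) \<and> m z \<in> c}"
    have finS: "finite S" using fin by (auto simp: S_def)
    interpret M: comm_group "fiber_group Q c" by (rule Q_comm_group[OF c])
    have comp: "a \<in> arrows (base P)" "b \<in> arrows (base P)" "\<alpha> a \<in> fiber P a" "\<beta> b \<in> fiber P b"
        "prd (base P) a b \<in> arrows (base P)"
      if "(a, b) \<in> composable (base P)" for a b
      using that \<alpha> \<beta> P_carrier_sections base.prd_closed by (auto simp: composable_def intro!: sections_fiber)
    have t_fiber: "t z \<in> fiber P (m z)" if "z \<in> composable (base P)" for z
      using prd_fiber(2) comp that by (cases z) (auto simp: t_def m_def)
    have t_zero: "t (a, b) = fzero P (m (a, b))"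
      if ab: "(a, b) \<in> composable (base P)" and "\<alpha> a = fzero P a \<or> \<beta> b = fzero P b" for a b
    proof -
      note G = comm_group.axioms(2)[OF P_comm_group]
      have "prd (total P) (fzero P a) (\<beta> b) = fzero P (m (a, b))"
        using hom_one[OF prd_hom(2)[OF ab comp(4)[OF ab]] G G] comp[OF ab] by (simp add: m_def)
      moreover have "prd (total P) (\<alpha> a) (fzero P b) = fzero P (m (a, b))"
        using hom_one[OF prd_hom(1)[OF ab comp(3)[OF ab]] G G] comp[OF ab] by (simp add: m_def)
      ultimately show ?thesis using that(2) by (auto simp: t_def)
    qed
    have pt: "p (t z) \<in> fiber Q c" if "z \<in> composable (base P)" "m z \<in> c" for z
      using p_class_fiber[OF c that(2) t_fiber[OF that(1)]] .
    define I where "I = {(d, e) \<in> composable (base Q). prd (base Q) d e = c}"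
    \<comment> \<open>One term of the convolution in the quotient, expanded by biadditivity.\<close>
    have term_eq: "finprod (fiber_group Q c) (\<lambda>z. p (t z)) {z \<in> S. h z = (d, e)} = prd (total Q) (T \<alpha> d) (T \<beta> e)"
      if "(d, e) \<in> I" for d e
    proof -
      have de: "(d, e) \<in> composable (base Q)" "prd (base Q) d e = c" using that by (auto simp: I_def)
      have de': "d \<in> arrows (base P) // EG" "e \<in> arrows (base P) // EG"
        using de(1) by (auto simp: composable_def)
      obtain a0 b0 where ab0: "d = q a0" "a0 \<in> arrows (base P)" "e = q b0" "b0 \<in> arrows (base P)"
        using de' by (auto elim!: quotientE)
      have comp0: "(a0, b0) \<in> composable (base P)"
        using de(1) Q_base(4)[OF ab0(2,4)] ab0(1,3) by simp
      have c_eq: "q (prd (base P) a0 b0) = c"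
        using de(2) Q_base(3)[OF comp0] ab0(1,3) by simp
      let ?A = "{a \<in> d. \<alpha> a \<noteq> fzero P a}" and ?B = "{b \<in> e. \<beta> b \<noteq> fzero P b}"
      have A: "T \<alpha> d = finprod (fiber_group Q d) (\<lambda>a. p (\<alpha> a)) ?A"
        by (rule T_eq_finprod[OF de'(1) finite_support_class[OF \<alpha> de'(1)]])
           (use carrier_class_fiber[OF \<alpha> de'(1)] in auto)
      have B: "T \<beta> e = finprod (fiber_group Q e) (\<lambda>b. p (\<beta> b)) ?B"
        by (rule T_eq_finprod[OF de'(2) finite_support_class[OF \<beta> de'(2)]])
           (use carrier_class_fiber[OF \<beta> de'(2)] in auto)
      have prd_ab: "(a, b) \<in> composable (base P)" "prd (base P) a b \<in> c" if "a \<in> d" "b \<in> e" for a b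
      proof -
        note a = class_arrow[OF de'(1) that(1)] and b = class_arrow[OF de'(2) that(2)]
        show ab: "(a, b) \<in> composable (base P)"
          using de(1) Q_base(4)[OF a(1) b(1)] a(2) b(2) by simp
        have "q (prd (base P) a b) = c"
          using de(2) Q_base(3)[OF ab] a(2) b(2) by simp
        then show "prd (base P) a b \<in> c" using EG_refl[OF comp(5)[OF ab]] by auto
      qed
      have AB: "?A \<times> ?B = {z \<in> S. h z = (d, e)}"
      proof (intro equalityI subsetI)
        fix z assume "z \<in> ?A \<times> ?B"
        then obtain a b where z: "z = (a, b)" "a \<in> d" "b \<in> e" "\<alpha> a \<noteq> fzero P a" "\<beta> b \<noteq> fzero P b" by auto
        note ab = prd_ab[OF z(2,3)]
        have "rng (base P) a = w" "src (base P) b = v"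
          using base.rng_prd[OF ab(1)] base.src_prd[OF ab(1)] c_sr[OF ab(2)] by auto
        then show "z \<in> {z \<in> S. h z = (d, e)}"
          using z ab comp[OF ab(1)] class_arrow(2)[OF de'(1) z(2)] class_arrow(2)[OF de'(2) z(3)]
          by (simp add: S_def A0_def B0_def m_def h_def)
      next
        fix z assume "z \<in> {z \<in> S. h z = (d, e)}"
        then obtain a b where z: "z = (a, b)" "a \<in> A0" "b \<in> B0" "q a = d" "q b = e"
          by (cases z) (auto simp: S_def h_def)
        then show "z \<in> ?A \<times> ?B"
          using EG_refl[of a] EG_refl[of b] by (auto simp: A0_def B0_def)
      qed
      have "prd (total Q) (T \<alpha> d) (T \<beta> e) =
          finprod (fiber_group Q c) (\<lambda>(a, b). prd (total Q) (p (\<alpha> a)) (p (\<beta> b))) (?A \<times> ?B)"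
        unfolding A B
      proof (rule finprod_biadditive[OF Q_comm_group[OF de'(1)] Q_comm_group[OF de'(2)] Q_comm_group[OF c]])
        show "(\<lambda>x. prd (total Q) x y) \<in> hom (fiber_group Q d) (fiber_group Q c)"
          if "y \<in> carrier (fiber_group Q e)" for y
          using Q_prd_hom(2)[OF comp0, of y] that ab0(1,3) c_eq by simp
        show "prd (total Q) x \<in> hom (fiber_group Q e) (fiber_group Q c)"
          if "x \<in> carrier (fiber_group Q d)" for x
          using Q_prd_hom(1)[OF comp0, of x] that ab0(1,3) c_eq by simp
        show "finite ?A" "finite ?B" using finite_support_class \<alpha> \<beta> de' by auto
        show "(\<lambda>a. p (\<alpha> a)) \<in> ?A \<rightarrow> carrier (fiber_group Q d)"
          using p_class_fiber[OF de'(1)] carrier_class_fiber[OF \<alpha> de'(1)] by auto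
        show "(\<lambda>b. p (\<beta> b)) \<in> ?B \<rightarrow> carrier (fiber_group Q e)"
          using p_class_fiber[OF de'(2)] carrier_class_fiber[OF \<beta> de'(2)] by auto
      qed
      also have "\<dots> = finprod (fiber_group Q c) (\<lambda>z. p (t z)) {z \<in> S. h z = (d, e)}"
      proof (rule M.finprod_cong'[OF AB])
        show "(\<lambda>z. p (t z)) \<in> {z \<in> S. h z = (d, e)} \<rightarrow> carrier (fiber_group Q c)"
          using pt by (auto simp: S_def)
        fix z assume z: "z \<in> {z \<in> S. h z = (d, e)}"
        obtain a b where ab: "z = (a, b)" by (cases z)
        then have "(a, b) \<in> composable (base P)" using z by (simp add: S_def)
        then show "(case z of (a, b) \<Rightarrow> prd (total Q) (p (\<alpha> a)) (p (\<beta> b))) = p (t z)"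
          using prd_fiber(3)[OF _ comp(3,4)] ab by (simp add: t_def)
      qed
      finally show ?thesis by simp
    qed
    have term_fiber: "prd (total Q) (T \<alpha> d) (T \<beta> e) \<in> fiber Q c" if "(d, e) \<in> I" for d e
    proof -
      have "finprod (fiber_group Q c) (\<lambda>z. p (t z)) {z \<in> S. h z = (d, e)} \<in> carrier (fiber_group Q c)"
        using pt by (intro M.finprod_closed) (auto simp: S_def)
      then show ?thesis using term_eq[OF that] by simp
    qed
    have h_S: "h ` S \<subseteq> I"
    proof
      fix z assume "z \<in> h ` S"
      then obtain a b where ab: "z = (q a, q b)" "(a, b) \<in> composable (base P)" "prd (base P) a b \<in> c"
        by (auto simp: S_def h_def m_def)
      then show "z \<in> I"
        using Q_base(3)[OF ab(2)] Q_base(4)[OF comp(1,2)[OF ab(2)]] class_arrow(2)[OF c ab(3)]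
        by (simp add: I_def)
    qed
    \<comment> \<open>One term of the sum over the class \<open>c\<close>, with its index set cut down to \<open>S\<close>.\<close>
    have conv: "convolution P \<alpha> \<beta> \<gamma> = finprod (fiber_group P \<gamma>) t {z \<in> S. m z = \<gamma>}" if \<gamma>: "\<gamma> \<in> c" for \<gamma>
    proof -
      have "convolution P \<alpha> \<beta> \<gamma> = fiber_sum P \<gamma> t {(a, b) \<in> composable (base P). prd (base P) a b = \<gamma>}"
        using class_arrow[OF c \<gamma>] by (simp add: convolution_def t_def)
      also have "\<dots> = finprod (fiber_group P \<gamma>) t {z \<in> S. m z = \<gamma>}"
      proof (rule fiber_sum_eq_finprod)
        show "comm_monoid (fiber_group P \<gamma>)"
          using P_comm_group[OF class_arrow(1)[OF c \<gamma>]] by (simp add: comm_group_def)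
        show "finite {z \<in> S. m z = \<gamma>}" using finS by simp
        show "{z \<in> S. m z = \<gamma>} \<subseteq> {(a, b) \<in> composable (base P). prd (base P) a b = \<gamma>}"
          by (auto simp: S_def m_def)
        show "t z \<in> fiber P \<gamma>" if "z \<in> {z \<in> S. m z = \<gamma>}" for z
          using t_fiber[of z] that by (auto simp: S_def)
        fix z assume z: "z \<in> {(a, b) \<in> composable (base P). prd (base P) a b = \<gamma>} - {z \<in> S. m z = \<gamma>}"
        obtain a b where ab: "z = (a, b)" by (cases z)
        have ab_comp: "(a, b) \<in> composable (base P)" "m (a, b) = \<gamma>" "(a, b) \<notin> S"
          using z ab by (auto simp: m_def)
        have "rng (base P) a = w" "src (base P) b = v"
          using base.rng_prd[OF ab_comp(1)] base.src_prd[OF ab_comp(1)] c_sr[OF \<gamma>] ab_comp(2) by (auto simp: m_def)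
        then have "\<alpha> a = fzero P a \<or> \<beta> b = fzero P b"
          using ab_comp \<gamma> comp[OF ab_comp(1)] by (auto simp: S_def A0_def B0_def)
        then show "t z = fzero P \<gamma>" using t_zero[OF ab_comp(1)] ab ab_comp(2) by simp
      qed
      finally show ?thesis .
    qed
    have conv_fiber: "convolution P \<alpha> \<beta> \<gamma> \<in> fiber P \<gamma>" if \<gamma>: "\<gamma> \<in> c" for \<gamma>
    proof -
      interpret N: comm_group "fiber_group P \<gamma>" by (rule P_comm_group[OF class_arrow(1)[OF c \<gamma>]])
      have "finprod (fiber_group P \<gamma>) t {z \<in> S. m z = \<gamma>} \<in> carrier (fiber_group P \<gamma>)"
        using t_fiber by (intro N.finprod_closed) (auto simp: S_def)
      then show ?thesis using conv[OF \<gamma>] by simp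
    qed
    have "T (convolution P \<alpha> \<beta>) c = finprod (fiber_group Q c) (\<lambda>\<gamma>. p (convolution P \<alpha> \<beta> \<gamma>)) (m ` S)"
    proof (rule T_eq_finprod[OF c _ _ conv_fiber])
      show "finite (m ` S)" "m ` S \<subseteq> c" using finS by (auto simp: S_def)
      show "convolution P \<alpha> \<beta> \<gamma> = fzero P \<gamma>" if \<gamma>: "\<gamma> \<in> c - m ` S" for \<gamma>
      proof -
        interpret N: comm_group "fiber_group P \<gamma>" using \<gamma> class_arrow(1)[OF c] by (intro P_comm_group) auto
        have empty: "{z \<in> S. m z = \<gamma>} = {}" using \<gamma> by auto
        have "convolution P \<alpha> \<beta> \<gamma> = finprod (fiber_group P \<gamma>) t {}"
          using conv[OF DiffD1[OF \<gamma>]] unfolding empty .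
        then show ?thesis using N.finprod_empty by simp
      qed
    qed
    also have "\<dots> = finprod (fiber_group Q c) (\<lambda>\<gamma>. finprod (fiber_group Q c) (\<lambda>z. p (t z)) {z \<in> S. m z = \<gamma>}) (m ` S)"
    proof (rule M.finprod_cong')
      show "(\<lambda>\<gamma>. finprod (fiber_group Q c) (\<lambda>z. p (t z)) {z \<in> S. m z = \<gamma>}) \<in> m ` S \<rightarrow> carrier (fiber_group Q c)"
        using pt by (auto intro!: M.finprod_closed simp: S_def simp del: fiber_group_simps) (auto)
      fix \<gamma> assume "\<gamma> \<in> m ` S"
      then have \<gamma>: "\<gamma> \<in> c" by (auto simp: S_def)
      note \<gamma>' = class_arrow[OF c \<gamma>]
      have "p (finprod (fiber_group P \<gamma>) t {z \<in> S. m z = \<gamma>}) = finprod (fiber_group Q c) (\<lambda>z. p (t z)) {z \<in> S. m z = \<gamma>}"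
        using p_hom[OF \<gamma>'(1)] \<gamma>'(2) t_fiber
        by (intro hom_finprod[OF P_comm_group[OF \<gamma>'(1)] Q_comm_group[OF c]]) (auto simp: S_def)
      then show "p (convolution P \<alpha> \<beta> \<gamma>) = finprod (fiber_group Q c) (\<lambda>z. p (t z)) {z \<in> S. m z = \<gamma>}"
        using conv[OF \<gamma>] by simp
    qed simp
    also have "\<dots> = finprod (fiber_group Q c) (\<lambda>z. p (t z)) S"
      using finS pt by (intro M.finprod_fibres) (auto simp: S_def)
    also have "\<dots> = finprod (fiber_group Q c) (\<lambda>de. finprod (fiber_group Q c) (\<lambda>z. p (t z)) {z \<in> S. h z = de}) (h ` S)"
      using finS pt by (intro M.finprod_fibres[symmetric]) (auto simp: S_def)
    also have "\<dots> = finprod (fiber_group Q c) (\<lambda>(d, e). prd (total Q) (T \<alpha> d) (T \<beta> e)) (h ` S)"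
    proof (rule M.finprod_cong')
      show "(\<lambda>(d, e). prd (total Q) (T \<alpha> d) (T \<beta> e)) \<in> h ` S \<rightarrow> carrier (fiber_group Q c)"
        using h_S term_fiber by (intro Pi_I) (auto split: prod.split)
      fix z assume z: "z \<in> h ` S"
      obtain d e where de: "z = (d, e)" by (cases z)
      have "(d, e) \<in> I" using subsetD[OF h_S z] unfolding de .
      then show "finprod (fiber_group Q c) (\<lambda>z. p (t z)) {y \<in> S. h y = z} =
          (case z of (d, e) \<Rightarrow> prd (total Q) (T \<alpha> d) (T \<beta> e))"
        using term_eq de by simp
    qed simp
    also have "\<dots> = fiber_sum Q c (\<lambda>(d, e). prd (total Q) (T \<alpha> d) (T \<beta> e)) I"
    proof (rule fiber_sum_eq_finprod[symmetric])
      show "comm_monoid (fiber_group Q c)" by (rule M.comm_monoid_axioms)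
      show "finite (h ` S)" using finS by simp
      show "h ` S \<subseteq> I" by (rule h_S)
      show "(case z of (d, e) \<Rightarrow> prd (total Q) (T \<alpha> d) (T \<beta> e)) \<in> fiber Q c" if "z \<in> h ` S" for z
        using subsetD[OF h_S that] term_fiber by (cases z) simp
      fix z assume z: "z \<in> I - h ` S"
      obtain d e where de: "z = (d, e)" by (cases z)
      have "h y \<noteq> (d, e)" if "y \<in> S" for y
      proof
        assume hy: "h y = (d, e)"
        have "z \<in> h ` S" using imageI[OF that, of h] unfolding hy de .
        then show False using z by simp
      qed
      then have empty: "{z \<in> S. h z = (d, e)} = {}" by simp
      have "(d, e) \<in> I" using z de by simp
      from term_eq[OF this, symmetric] have "prd (total Q) (T \<alpha> d) (T \<beta> e) = finprod (fiber_group Q c) (\<lambda>z. p (t z)) {}"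
        unfolding empty .
      then show "(case z of (d, e) \<Rightarrow> prd (total Q) (T \<alpha> d) (T \<beta> e)) = fzero Q c"
        using de by simp
    qed
    also have "\<dots> = convolution Q (T \<alpha>) (T \<beta>) c"
      using c by (simp add: convolution_def I_def)
    finally show ?thesis .
  qed (simp add: convolution_def quotient_sum_map_def)
qed

section \<open>Summation over classes preserves the sectional algebras\<close>

text \<open>Each class contains at most one arrow of \<open>U\<close>, so the sum has at most one nonzero term.\<close>

lemma T_supported_on_injective_set:
  assumes U: "U \<subseteq> arrows (base P)" "inj_on (\<lambda>\<gamma>. q \<gamma>) U"
    and \<alpha>: "\<alpha> \<in> sections P" "\<And>\<gamma>. \<gamma> \<in> arrows (base P) - U \<Longrightarrow> \<alpha> \<gamma> = fzero P \<gamma>"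
  shows "\<gamma> \<in> U \<Longrightarrow> T \<alpha> (q \<gamma>) = p (\<alpha> \<gamma>)"
    and "c \<in> arrows (base P) // EG \<Longrightarrow> c \<notin> (\<lambda>\<gamma>. q \<gamma>) ` U \<Longrightarrow> T \<alpha> c = fzero Q c"
proof -
  have fib: "\<alpha> \<delta> \<in> fiber P \<delta>" if "c \<in> arrows (base P) // EG" "\<delta> \<in> c" for c \<delta>
    using class_arrow(1)[OF that] \<alpha>(1) by (rule sections_fiber[rotated])
  show "T \<alpha> (q \<gamma>) = p (\<alpha> \<gamma>)" if \<gamma>: "\<gamma> \<in> U"
  proof -
    have \<gamma>': "\<gamma> \<in> arrows (base P)" using \<gamma> U(1) by blast
    then have c: "q \<gamma> \<in> arrows (base P) // EG" by (rule quotientI)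
    interpret comm_group "fiber_group Q (q \<gamma>)" by (rule Q_comm_group[OF c])
    have mem: "\<gamma> \<in> q \<gamma>" using EG_refl[OF \<gamma>'] by simp
    have "T \<alpha> (q \<gamma>) = finprod (fiber_group Q (q \<gamma>)) (\<lambda>\<gamma>. p (\<alpha> \<gamma>)) {\<gamma>}"
    proof (rule T_eq_finprod[OF c _ _ fib[OF c]])
      fix \<delta> assume \<delta>: "\<delta> \<in> q \<gamma> - {\<gamma>}"
      then have "q \<delta> = q \<gamma>" "\<delta> \<in> arrows (base P)" using class_arrow[OF c] by auto
      then have "\<delta> \<notin> U" using \<delta> inj_onD[OF U(2) _ _ \<gamma>, of \<delta>] by auto
      then show "\<alpha> \<delta> = fzero P \<delta>" using \<alpha>(2) \<open>\<delta> \<in> arrows (base P)\<close> by simp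
    qed (use mem in auto)
    also have "\<dots> = p (\<alpha> \<gamma>)"
      using p_class_fiber[OF c mem fib[OF c mem]] finprod_singleton[of \<gamma> "{\<gamma>}" "\<lambda>\<gamma>. p (\<alpha> \<gamma>)"] by simp
    finally show ?thesis .
  qed
  show "T \<alpha> c = fzero Q c" if c: "c \<in> arrows (base P) // EG" "c \<notin> (\<lambda>\<gamma>. q \<gamma>) ` U"
  proof -
    interpret comm_group "fiber_group Q c" by (rule Q_comm_group[OF c(1)])
    have "\<alpha> \<delta> = fzero P \<delta>" if "\<delta> \<in> c" for \<delta>
      using c(2) class_arrow[OF c(1) that] by (intro \<alpha>(2)) blast
    then have "T \<alpha> c = finprod (fiber_group Q c) (\<lambda>\<gamma>. p (\<alpha> \<gamma>)) {}"
      by (intro T_eq_finprod[OF c(1) _ _ fib[OF c(1)]]) auto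
    then show ?thesis by simp
  qed
qed

text \<open>On \<open>q ` U\<close> the section \<open>T \<alpha>\<close> is \<open>p \<circ> \<alpha>\<close> composed with the inverse of the homeomorphism that \<open>q\<close> induces on
  \<open>U\<close>.\<close>

lemma T_Cc_sections_injective_set:
  assumes U: "openin X U" "inj_on (\<lambda>\<gamma>. q \<gamma>) U" "Hausdorff_space (subtopology X U)"
    and \<alpha>: "\<alpha> \<in> sectional_carrier P" "\<alpha> \<in> Cc_sections P U"
  shows "T \<alpha> \<in> sectional_carrier Q"
proof -
  let ?V = "(\<lambda>\<gamma>. q \<gamma>) ` U"
  have U': "U \<subseteq> arrows (base P)" using U(1) by (rule openin_subset)
  have \<alpha>': "\<alpha> \<in> sections P" "\<And>\<gamma>. \<gamma> \<in> arrows (base P) - U \<Longrightarrow> \<alpha> \<gamma> = fzero P \<gamma>"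
    "continuous_map (subtopology X U) L \<alpha>"
    using \<alpha>(2) by (auto simp: Cc_sections_def)
  have T: "\<And>\<gamma>. \<gamma> \<in> U \<Longrightarrow> T \<alpha> (q \<gamma>) = p (\<alpha> \<gamma>)"
    "\<And>c. c \<in> arrows (base P) // EG \<Longrightarrow> c \<notin> ?V \<Longrightarrow> T \<alpha> c = fzero Q c"
    using T_supported_on_injective_set[OF U' U(2) \<alpha>'(1)] \<alpha>'(2) by auto
  have "homeomorphic_map (subtopology X U) (subtopology (quotient_topology X EG) ?V) (\<lambda>\<gamma>. q \<gamma>)"
    by (rule homeomorphic_map_open_inj[OF q_quotient(1,2) U(1,2)])
  then have Haus: "Hausdorff_space (subtopology (quotient_topology X EG) ?V)"
    using U(3) homeomorphic_Hausdorff_space homeomorphic_map_imp_homeomorphic_space by blast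
  have op: "openin (quotient_topology X EG) ?V"
    using q_quotient(2) U(1) by (auto simp: open_map_def)
  obtain K where K: "compactin X K" "K \<subseteq> U" "\<And>\<gamma>. \<gamma> \<in> arrows (base P) - K \<Longrightarrow> \<alpha> \<gamma> = fzero P \<gamma>"
    by (rule Cc_sections_compact[OF \<alpha>(2)]) auto
  have "T \<alpha> \<in> Cc_sections Q ?V"
  proof (rule Cc_sectionsI, unfold base_Q total_Q arrow_space_quotient)
    show "T \<alpha> \<in> sections Q" using \<alpha>(1) by (rule T_sections)
    show "compactin (quotient_topology X EG) ((\<lambda>\<gamma>. q \<gamma>) ` K)"
      using image_compactin[OF K(1) q_quotient(1)] .
    show "(\<lambda>\<gamma>. q \<gamma>) ` K \<subseteq> ?V" using K(2) by blast
    show "T \<alpha> c = fzero Q c" if c: "c \<in> topspace (quotient_topology X EG) - (\<lambda>\<gamma>. q \<gamma>) ` K" for c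
    proof (cases "c \<in> ?V")
      case True
      then obtain \<gamma> where \<gamma>: "\<gamma> \<in> U" "c = q \<gamma>" by blast
      then have "\<gamma> \<in> arrows (base P) - K" using c U' by auto
      then show ?thesis using T(1)[OF \<gamma>(1)] K(3)[of \<gamma>] \<gamma>(2) fzero_Q[of \<gamma>] by simp
    next
      case False
      then show ?thesis using T(2)[of c] c by simp
    qed
    have "continuous_map (subtopology (quotient_topology X EG) ?V) (subtopology X U) (inv_into U (\<lambda>\<gamma>. q \<gamma>))"
      using continuous_inv_into_open_inj[OF q_quotient(2) U(1,2)] 
      by (auto simp: continuous_map_in_subtopology inv_into_into quotientI)
    from continuous_map_compose[OF this continuous_map_compose[OF \<alpha>'(3) p_quotient(1)]]
    show "continuous_map (subtopology (quotient_topology X EG) ?V) (quotient_topology L EL) (T \<alpha>)"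
    proof (rule continuous_map_eq)
      fix c assume "c \<in> topspace (subtopology (quotient_topology X EG) ?V)"
      then obtain \<gamma> where \<gamma>: "\<gamma> \<in> U" "c = q \<gamma>" by auto
      have "inv_into U (\<lambda>\<gamma>. q \<gamma>) c = \<gamma>" unfolding \<gamma>(2) using inv_into_f_f[OF U(2) \<gamma>(1)] .
      then show "((\<lambda>x. p x) \<circ> \<alpha> \<circ> inv_into U (\<lambda>\<gamma>. q \<gamma>)) c = T \<alpha> c"
        using T(1)[OF \<gamma>(1)] \<gamma>(2) by simp
    qed
  qed (rule Haus)
  then show ?thesis
    using op Haus by (intro sectional_carrier.generator[of Q ?V]) simp_all
qed

lemma continuous_scale:
  assumes "continuous_map Y euclidean f" "continuous_map Y L \<alpha>"
  shows "continuous_map Y L (\<lambda>y. flscale P (f y) (\<alpha> y))"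
  using continuous_map_compose[OF continuous_map_pairedI[OF assms] continuous_flscale]
  by (simp add: o_def)

text \<open>A general open Hausdorff set \<open>V\<close> is handled by a partition of unity subordinate to open sets on which \<open>q\<close>
  is injective.\<close>

lemma T_Cc_sections:
  assumes V: "openin X V" "Hausdorff_space (subtopology X V)" and \<alpha>: "\<alpha> \<in> Cc_sections P V"
  shows "T \<alpha> \<in> sectional_carrier Q"
proof -
  let ?S = "{\<beta> \<in> sectional_carrier P. T \<beta> \<in> sectional_carrier Q}"
  have \<alpha>': "\<alpha> \<in> sections P" "continuous_map (subtopology X V) L \<alpha>"
    using \<alpha> by (auto simp: Cc_sections_def)
  have "\<alpha> \<in> ?S"
  proof (rule Cc_sections_partition_of_unity[OF fiber_bimodule bump_space_base V \<alpha>])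
    show "?S \<subseteq> sections P" using P_carrier_sections by blast
    show "section_zero P \<in> ?S"
      using sectional_carrier.zero[of P] sectional_carrier.zero[of Q] T_zero by simp
    show "section_add P \<beta> \<gamma> \<in> ?S" if "\<beta> \<in> ?S" "\<gamma> \<in> ?S" for \<beta> \<gamma>
      using that T_add[of \<beta> \<gamma>] sectional_carrier.add[of \<beta> P \<gamma>] sectional_carrier.add[of "T \<beta>" Q "T \<gamma>"] by simp
    fix x assume x: "x \<in> V"
    then obtain U0 where U0: "openin X U0" "x \<in> U0" "inj_on (\<lambda>\<gamma>. q \<gamma>) U0"
      using locally_injective_q openin_subset[OF V(1)] by (metis subsetD)
    define U where "U = U0 \<inter> V"
    have U: "openin X U" "x \<in> U" "U \<subseteq> V" "inj_on (\<lambda>\<gamma>. q \<gamma>) U"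
      using U0 V(1) x by (auto simp: U_def intro: inj_on_subset)
    have "Hausdorff_space (subtopology (subtopology X V) U)"
      using V(2) Hausdorff_space_subtopology by blast
    then have Haus: "Hausdorff_space (subtopology X U)"
      using U(3) by (simp add: subtopology_subtopology Int_absorb1)
    show "\<exists>U. openin X U \<and> x \<in> U \<and> U \<subseteq> V \<and>
        (\<forall>f C. continuous_map (subtopology X V) euclidean f \<longrightarrow> compactin X C \<longrightarrow> C \<subseteq> U \<longrightarrow>
           (\<forall>y. y \<notin> C \<longrightarrow> f y = 0) \<longrightarrow> scale_section P f \<alpha> \<in> ?S)"
    proof (intro exI[of _ U] conjI allI impI U)
      fix f :: "'g \<Rightarrow> 'r" and C assume f: "continuous_map (subtopology X V) euclidean f" "compactin X C" "C \<subseteq> U"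
        "\<forall>y. y \<notin> C \<longrightarrow> f y = 0"
      have "scale_section P f \<alpha> \<in> Cc_sections P U"
      proof (rule Cc_sectionsI[OF Haus _ f(2,3)])
        show "scale_section P f \<alpha> \<in> sections P"
          unfolding scale_section_def using \<alpha>'(1) by (intro sections_restrict fiber_lscale sections_fiber)
        show "scale_section P f \<alpha> \<gamma> = fzero P \<gamma>" if "\<gamma> \<in> arrows (base P) - C" for \<gamma>
          using that f(4) bimodule.ls_zero[OF fiber_bimodule] sections_fiber[OF \<alpha>'(1), of \<gamma>]
          by (simp add: scale_section_def)
        have "continuous_map (subtopology X U) L (\<lambda>y. flscale P (f y) (\<alpha> y))"
          by (intro continuous_scale continuous_map_from_subtopology_mono[OF f(1) U(3)]
              continuous_map_from_subtopology_mono[OF \<alpha>'(2) U(3)])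
        then show "continuous_map (subtopology X U) L (scale_section P f \<alpha>)"
          by (rule continuous_map_eq) (simp add: scale_section_def)
      qed
      then show "scale_section P f \<alpha> \<in> ?S"
        using T_Cc_sections_injective_set[OF U(1,4) Haus] sectional_carrier.generator[OF U(1) Haus] by simp
    qed
  qed
  then show ?thesis by simp
qed

lemma T_carrier:
  assumes "\<alpha> \<in> sectional_carrier P"
  shows "T \<alpha> \<in> sectional_carrier Q"
  using assms
proof induction
  case (generator V \<alpha>)
  then show ?case by (rule T_Cc_sections)
next
  case zero
  then show ?case using T_zero sectional_carrier.zero[of Q] by simp
next
  case (add \<alpha> \<beta>)
  then show ?case using T_add sectional_carrier.add[of _ Q] by simp
next
  case (lscale \<alpha> r)
  then show ?case using T_lscale sectional_carrier.lscale[of _ Q] by simp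
next
  case (rscale \<alpha> r)
  then show ?case using T_rscale sectional_carrier.rscale[of _ Q] by simp
qed

section \<open>Local lifts and surjectivity\<close>

text \<open>Let \<open>l\<close> over \<open>\<gamma>\<close> represent \<open>\<xi> (q \<gamma>)\<close>, and let \<open>s\<close> be the inverse of \<open>p\<close> on an open set \<open>N\<close> around \<open>l\<close> on
  which \<open>p\<close> is injective. Then \<open>a = s \<circ> \<xi> \<circ> q\<close> satisfies \<open>p \<circ> a = \<xi> \<circ> q\<close>, but a priori \<open>a \<delta>\<close> only lies over an
  arrow equivalent to \<open>\<delta>\<close>. Since \<open>a \<gamma> = l\<close> lies over \<open>\<gamma>\<close> itself, continuity keeps that arrow in a
  neighbourhood \<open>U0\<close> of \<open>\<gamma>\<close> on which \<open>q\<close> is injective, and there equivalent arrows coincide.\<close>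

lemma local_lift_of_section:
  assumes triv: "locally_trivial_equiv L EL"
    and W: "openin (quotient_topology X EG) W"
    and \<xi>: "\<xi> \<in> sections Q" "continuous_map (subtopology (quotient_topology X EG) W) (quotient_topology L EL) \<xi>"
    and \<gamma>: "\<gamma> \<in> arrows (base P)" "q \<gamma> \<in> W"
  shows "\<exists>U a. openin X U \<and> \<gamma> \<in> U \<and> inj_on (\<lambda>\<gamma>. q \<gamma>) U \<and> (\<lambda>\<gamma>. q \<gamma>) ` U \<subseteq> W \<and>
    continuous_map (subtopology X U) L a \<and> (\<forall>\<delta>\<in>U. a \<delta> \<in> fiber P \<delta> \<and> p (a \<delta>) = \<xi> (q \<delta>))"
proof -
  have \<xi>_fiber: "\<xi> (q \<delta>) \<in> fiber Q (q \<delta>)" if "\<delta> \<in> arrows (base P)" for \<delta>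
    using sections_fiber[OF \<xi>(1)] that by (simp add: quotientI)
  obtain l where l: "l \<in> fiber P \<gamma>" "\<xi> (q \<gamma>) = p l"
    using fiber_Q_lift[OF \<xi>_fiber[OF \<gamma>(1)] \<gamma>(1)] .
  obtain \<B> where \<B>: "openin L = arbitrary union_of (\<lambda>U. U \<in> \<B>)"
    and inj: "\<And>U x y. U \<in> \<B> \<Longrightarrow> x \<in> U \<Longrightarrow> y \<in> U \<Longrightarrow> (x, y) \<in> EL \<Longrightarrow> x = y"
    using triv unfolding locally_trivial_equiv_def by metis
  have "(arbitrary union_of (\<lambda>U. U \<in> \<B>)) (topspace L)"
    using \<B> openin_topspace[of L] by metis
  then obtain \<U> where "\<U> \<subseteq> \<B>" "\<Union>\<U> = topspace L" unfolding union_of_def by auto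
  then obtain N where N: "N \<in> \<B>" "l \<in> N"
    using fiberD(1)[OF l(1)] by blast
  have N_open: "openin L N"
    unfolding \<B> using N(1) by (rule arbitrary_union_of_inc)
  have p_inj: "inj_on (\<lambda>x. p x) N"
    using inj[OF N(1)] eq_equiv_class[OF _ equiv_total] openin_subset[OF N_open] by (intro inj_onI) blast
  define s where "s = inv_into N (\<lambda>x. p x)"
  have s_cont: "continuous_map (subtopology (quotient_topology L EL) ((\<lambda>x. p x) ` N)) L s"
    unfolding s_def using continuous_inv_into_open_inj[OF p_quotient(2) N_open p_inj] by (auto simp: quotientI)
  obtain U0 where U0: "openin X U0" "\<gamma> \<in> U0" "inj_on (\<lambda>\<gamma>. q \<gamma>) U0" using locally_injective_q[OF \<gamma>(1)] by blast
  define W' where "W' = {\<delta> \<in> arrows (base P). q \<delta> \<in> W}"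
  have W': "openin X W'"
    using q_quotient(1) W unfolding W'_def continuous_map_def by blast
  have "continuous_map (subtopology X W') (subtopology (quotient_topology X EG) W) (\<lambda>\<gamma>. q \<gamma>)"
    using q_quotient(1) by (auto simp: continuous_map_in_subtopology continuous_map_from_subtopology W'_def)
  from continuous_map_compose[OF this \<xi>(2)]
  have \<xi>q: "continuous_map (subtopology X W') (quotient_topology L EL) (\<lambda>\<delta>. \<xi> (q \<delta>))" by (simp add: o_def)
  have pN: "openin (quotient_topology L EL) ((\<lambda>x. p x) ` N)"
    using p_quotient(2) N_open by (auto simp: open_map_def)
  define U1 where "U1 = {\<delta> \<in> W'. \<xi> (q \<delta>) \<in> (\<lambda>x. p x) ` N} \<inter> U0"
  have topW': "topspace (subtopology X W') = W'" by (auto simp: W'_def)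
  have "openin (subtopology X W') {\<delta> \<in> W'. \<xi> (q \<delta>) \<in> (\<lambda>x. p x) ` N}"
    using openin_continuous_map_preimage[OF \<xi>q pN] unfolding topW' .
  then have "openin X {\<delta> \<in> W'. \<xi> (q \<delta>) \<in> (\<lambda>x. p x) ` N}"
    using W' by (rule openin_trans_full)
  then have U1: "openin X U1" unfolding U1_def using U0(1) by (rule openin_Int)
  define a where "a \<delta> = s (\<xi> (q \<delta>))" for \<delta>
  have "continuous_map (subtopology X U1) (quotient_topology L EL) (\<lambda>\<delta>. \<xi> (q \<delta>))"
    by (rule continuous_map_from_subtopology_mono[OF \<xi>q]) (auto simp: U1_def)
  then have "continuous_map (subtopology X U1) (subtopology (quotient_topology L EL) ((\<lambda>x. p x) ` N)) (\<lambda>\<delta>. \<xi> (q \<delta>))"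
    by (rule continuous_map_into_subtopology) (auto simp: U1_def)
  from continuous_map_compose[OF this s_cont]
  have a_cont: "continuous_map (subtopology X U1) L a" by (simp add: o_def a_def[abs_def])
  have pa: "p (a \<delta>) = \<xi> (q \<delta>)" "a \<delta> \<in> arrows (total P)" if "\<delta> \<in> U1" for \<delta>
  proof -
    have \<delta>: "\<xi> (q \<delta>) \<in> (\<lambda>x. p x) ` N" using that by (simp add: U1_def)
    show "p (a \<delta>) = \<xi> (q \<delta>)" using f_inv_into_f[OF \<delta>] by (simp add: a_def s_def)
    show "a \<delta> \<in> arrows (total P)"
      using inv_into_into[OF \<delta>] openin_subset[OF N_open] by (auto simp: a_def s_def)
  qed
  have a\<gamma>: "a \<gamma> = l" unfolding a_def l(2) s_def using inv_into_f_f[OF p_inj N(2)] .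
  have \<gamma>U1: "\<gamma> \<in> U1" using \<gamma> U0(2) l(2) N(2) by (simp add: U1_def W'_def)
  \<comment> \<open>The condition that makes \<open>a\<close> a section.\<close>
  define U where "U = {\<delta> \<in> U1. proj P (a \<delta>) \<in> U0}"
  have topU1: "topspace (subtopology X U1) = U1" using openin_subset[OF U1] by auto
  have "continuous_map (subtopology X U1) X (\<lambda>\<delta>. proj P (a \<delta>))"
    using continuous_map_compose[OF a_cont continuous_proj] by (simp add: o_def)
  from openin_continuous_map_preimage[OF this U0(1)] have "openin (subtopology X U1) U"
    unfolding topU1 U_def .
  then have U: "openin X U" using U1 by (rule openin_trans_full)
  have "a \<delta> \<in> fiber P \<delta>" if \<delta>: "\<delta> \<in> U" for \<delta>
  proof -
    have \<delta>': "\<delta> \<in> U1" "\<delta> \<in> U0" "\<delta> \<in> arrows (base P)" "proj P (a \<delta>) \<in> U0"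
      using \<delta> by (auto simp: U_def U1_def W'_def)
    have "q (proj P (a \<delta>)) = proj Q (\<xi> (q \<delta>))"
      using pa[OF \<delta>'(1)] proj_Q by metis
    also have "\<dots> = q \<delta>" using \<xi>_fiber[OF \<delta>'(3)] by (simp add: fiber_def)
    finally have "proj P (a \<delta>) = \<delta>" using inj_onD[OF U0(3) _ \<delta>'(4,2)] by simp
    then show ?thesis using pa(2)[OF \<delta>'(1)] by (simp add: fiber_def)
  qed
  moreover have "\<gamma> \<in> U" using \<gamma>U1 a\<gamma> fiberD(2)[OF l(1)] U0(2) by (simp add: U_def)
  moreover have "inj_on (\<lambda>\<gamma>. q \<gamma>) U" using U0(3) by (rule inj_on_subset) (auto simp: U_def U1_def)
  moreover have "(\<lambda>\<gamma>. q \<gamma>) ` U \<subseteq> W" by (auto simp: U_def U1_def W'_def)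
  moreover have "continuous_map (subtopology X U) L a"
    by (rule continuous_map_from_subtopology_mono[OF a_cont]) (auto simp: U_def)
  moreover have "p (a \<delta>) = \<xi> (q \<delta>)" if "\<delta> \<in> U" for \<delta> using pa(1) that by (simp add: U_def)
  ultimately show ?thesis using U by blast
qed

text \<open>A local lift \<open>a\<close> of \<open>\<xi>\<close> is defined on \<open>U\<close> only. Multiplied by the pullback of a function with compact
  support in \<open>q ` U\<close>, it extends by zero to a section of the whole bundle, whose image under \<open>T\<close> is the
  corresponding multiple of \<open>\<xi>\<close>.\<close>

lemma scaled_lift_in_range:
  assumes W: "openin (quotient_topology X EG) W" "Hausdorff_space (subtopology (quotient_topology X EG) W)"
    and \<xi>: "\<xi> \<in> sections Q"
    and U: "openin X U" "inj_on (\<lambda>\<gamma>. q \<gamma>) U" "(\<lambda>\<gamma>. q \<gamma>) ` U \<subseteq> W"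
    and a: "continuous_map (subtopology X U) L a"
      "\<And>\<delta>. \<delta> \<in> U \<Longrightarrow> a \<delta> \<in> fiber P \<delta>" "\<And>\<delta>. \<delta> \<in> U \<Longrightarrow> p (a \<delta>) = \<xi> (q \<delta>)"
    and f: "continuous_map (subtopology (quotient_topology X EG) W) euclidean f"
      "compactin (quotient_topology X EG) C" "C \<subseteq> (\<lambda>\<gamma>. q \<gamma>) ` U" "\<And>c. c \<notin> C \<Longrightarrow> f c = 0"
  shows "scale_section Q f \<xi> \<in> T ` sectional_carrier P"
proof -
  let ?V = "(\<lambda>\<gamma>. q \<gamma>) ` U"
  have U': "U \<subseteq> arrows (base P)" using U(1) by (rule openin_subset)
  have homeo: "homeomorphic_map (subtopology X U) (subtopology (quotient_topology X EG) ?V) (\<lambda>\<gamma>. q \<gamma>)"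
    by (rule homeomorphic_map_open_inj[OF q_quotient(1,2) U(1,2)])
  have "Hausdorff_space (subtopology (subtopology (quotient_topology X EG) W) ?V)"
    using W(2) Hausdorff_space_subtopology by blast
  then have "Hausdorff_space (subtopology (quotient_topology X EG) ?V)"
    using U(3) by (simp add: subtopology_subtopology Int_absorb1)
  then have Haus: "Hausdorff_space (subtopology X U)"
    using homeo homeomorphic_Hausdorff_space homeomorphic_map_imp_homeomorphic_space by blast
  define K where "K = {\<delta> \<in> U. q \<delta> \<in> C}"
  have qK: "(\<lambda>\<gamma>. q \<gamma>) ` K = C" using f(3) by (auto simp: K_def)
  have "K \<subseteq> topspace (subtopology X U)" using U' by (auto simp: K_def)
  then have "compactin (subtopology X U) K"
    using homeomorphic_map_compactness[OF homeo, of K] f(2,3) unfolding qK by (simp add: compactin_subtopology)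
  then have K: "compactin X K" by (simp add: compactin_subtopology)
  define \<alpha> where "\<alpha> = (\<lambda>\<delta>\<in>arrows (base P). if \<delta> \<in> U then flscale P (f (q \<delta>)) (a \<delta>) else fzero P \<delta>)"
  have \<alpha>_sec: "\<alpha> \<in> sections P"
    unfolding \<alpha>_def using a(2) fiber_lscale fiber_zero by (intro sections_restrict) simp
  have \<alpha>_cc: "\<alpha> \<in> Cc_sections P U"
  proof (rule Cc_sectionsI[OF Haus \<alpha>_sec K])
    show "K \<subseteq> U" by (auto simp: K_def)
    show "\<alpha> \<gamma> = fzero P \<gamma>" if \<gamma>: "\<gamma> \<in> arrows (base P) - K" for \<gamma>
    proof (cases "\<gamma> \<in> U")
      case True
      then have "f (q \<gamma>) = 0" using \<gamma> f(4) by (simp add: K_def)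
      then show ?thesis
        using True \<gamma> a(2)[OF True] bimodule.ls_zero[OF fiber_bimodule] by (simp add: \<alpha>_def)
    qed (use \<gamma> in \<open>simp add: \<alpha>_def\<close>)
    have "continuous_map (subtopology X U) (subtopology (quotient_topology X EG) W) (\<lambda>\<gamma>. q \<gamma>)"
      using q_quotient(1) U(3) by (auto simp: continuous_map_in_subtopology continuous_map_from_subtopology)
    from continuous_scale[OF continuous_map_compose[OF this f(1)] a(1)]
    show "continuous_map (subtopology X U) L \<alpha>"
      by (rule continuous_map_eq) (simp add: \<alpha>_def)
  qed
  have \<alpha>_zero: "\<alpha> \<gamma> = fzero P \<gamma>" if "\<gamma> \<in> arrows (base P) - U" for \<gamma>
    using that by (simp add: \<alpha>_def)
  have \<alpha>_car: "\<alpha> \<in> sectional_carrier P"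
    using U(1) Haus \<alpha>_cc by (rule sectional_carrier.generator)
  have T: "\<And>\<gamma>. \<gamma> \<in> U \<Longrightarrow> T \<alpha> (q \<gamma>) = p (\<alpha> \<gamma>)"
    "\<And>c. c \<in> arrows (base P) // EG \<Longrightarrow> c \<notin> ?V \<Longrightarrow> T \<alpha> c = fzero Q c"
    using T_supported_on_injective_set[OF U' U(2) \<alpha>_sec] \<alpha>_zero by auto
  have "T \<alpha> = scale_section Q f \<xi>"
  proof (rule ext)
    fix c
    show "T \<alpha> c = scale_section Q f \<xi> c"
    proof (cases "c \<in> arrows (base P) // EG")
      case c: True
      have scale: "scale_section Q f \<xi> c = flscale Q (f c) (\<xi> c)"
        using c by (simp add: scale_section_def)
      show ?thesis
      proof (cases "c \<in> ?V")
        case True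
        then obtain \<delta> where \<delta>: "\<delta> \<in> U" "c = q \<delta>" by blast
        have "T \<alpha> c = p (flscale P (f c) (a \<delta>))"
          using T(1)[OF \<delta>(1)] \<delta> U' by (simp add: \<alpha>_def subset_iff)
        also have "\<dots> = flscale Q (f c) (p (a \<delta>))"
          using flscale_Q[OF fiberD(1)[OF a(2)[OF \<delta>(1)]]] by simp
        finally show ?thesis using scale a(3)[OF \<delta>(1)] \<delta>(2) by metis
      next
        case False
        then have "f c = 0" using f(3,4) by blast
        moreover have "\<xi> c \<in> fiber Q c" using sections_fiber[OF \<xi>] c by simp
        ultimately show ?thesis
          using T(2)[OF c False] scale bimodule.ls_zero[OF Q_bimodule[OF c], of "\<xi> c"] by simp
      qed
    qed (simp add: scale_section_def quotient_sum_map_def)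
  qed
  then show ?thesis using \<alpha>_car by (metis imageI)
qed

text \<open>The image of \<open>T\<close> is closed under the module operations, so only generators matter, and these are cut into
  liftable pieces by a partition of unity on the quotient.\<close>

lemma T_onto_if_locally_trivial:
  assumes "locally_trivial_equiv L EL" "\<xi> \<in> sectional_carrier Q"
  shows "\<xi> \<in> T ` sectional_carrier P"
  using assms(2)
proof induction
  case (generator W \<xi>)
  let ?Y = "quotient_topology X EG"
  have W: "openin ?Y W" "Hausdorff_space (subtopology ?Y W)" using generator(1,2) by simp_all
  have \<xi>: "\<xi> \<in> sections Q" "continuous_map (subtopology ?Y W) (quotient_topology L EL) \<xi>"
    using generator(3) by (auto simp: Cc_sections_def)
  show ?case
  proof (rule Cc_sections_partition_of_unity[OF _ bump_space_quotient_base generator])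
    show "bimodule (fiber_group Q c) (flscale Q) (frscale Q)" if "c \<in> arrows (base Q)" for c
      using that Q_bimodule by simp
    show "T ` sectional_carrier P \<subseteq> sections Q" using T_sections by blast
    show "section_zero Q \<in> T ` sectional_carrier P"
      using T_zero sectional_carrier.zero[of P] by (metis imageI)
    show "section_add Q \<alpha> \<beta> \<in> T ` sectional_carrier P"
      if \<alpha>\<beta>: "\<alpha> \<in> T ` sectional_carrier P" "\<beta> \<in> T ` sectional_carrier P" for \<alpha> \<beta>
    proof -
      obtain \<alpha>' \<beta>' where "\<alpha>' \<in> sectional_carrier P" "\<alpha> = T \<alpha>'" "\<beta>' \<in> sectional_carrier P" "\<beta> = T \<beta>'"
        using \<alpha>\<beta> by blast
      then show ?thesis using T_add[of \<alpha>' \<beta>'] sectional_carrier.add[of \<alpha>' P \<beta>'] by (metis imageI)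
    qed
    fix x assume x: "x \<in> W"
    then have "x \<in> arrows (base P) // EG" using openin_subset[OF W(1)] by auto
    then obtain \<gamma> where \<gamma>: "x = q \<gamma>" "\<gamma> \<in> arrows (base P)" by (rule quotientE)
    obtain U a where U: "openin X U" "\<gamma> \<in> U" "inj_on (\<lambda>\<gamma>. q \<gamma>) U" "(\<lambda>\<gamma>. q \<gamma>) ` U \<subseteq> W"
      and a: "continuous_map (subtopology X U) L a"
        "\<And>\<delta>. \<delta> \<in> U \<Longrightarrow> a \<delta> \<in> fiber P \<delta>" "\<And>\<delta>. \<delta> \<in> U \<Longrightarrow> p (a \<delta>) = \<xi> (q \<delta>)"
      using local_lift_of_section[OF assms(1) W(1) \<xi> \<gamma>(2)] x \<gamma>(1) by blast
    have "openin ?Y ((\<lambda>\<gamma>. q \<gamma>) ` U)"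
      using q_quotient(2) U(1) by (auto simp: open_map_def)
    moreover have "x \<in> (\<lambda>\<gamma>. q \<gamma>) ` U" using U(2) \<gamma>(1) by simp
    moreover have "scale_section Q f \<xi> \<in> T ` sectional_carrier P"
      if "continuous_map (subtopology ?Y W) euclidean f" "compactin ?Y C" "C \<subseteq> (\<lambda>\<gamma>. q \<gamma>) ` U"
        "\<forall>y. y \<notin> C \<longrightarrow> f y = 0" for f :: "'g set \<Rightarrow> 'r" and C
      using that(4) by (intro scaled_lift_in_range[OF W \<xi>(1) U(1,3,4) a that(1-3)]) auto
    ultimately show "\<exists>U. openin (arrow_space (base Q)) U \<and> x \<in> U \<and> U \<subseteq> W \<and>
        (\<forall>f C. continuous_map (subtopology (arrow_space (base Q)) W) euclidean f \<longrightarrow>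
           compactin (arrow_space (base Q)) C \<longrightarrow> C \<subseteq> U \<longrightarrow>
           (\<forall>y. y \<notin> C \<longrightarrow> f y = 0) \<longrightarrow> scale_section Q f \<xi> \<in> T ` sectional_carrier P)"
      unfolding base_Q arrow_space_quotient using U(4)
      by (intro exI[of _ "(\<lambda>\<gamma>. q \<gamma>) ` U"] conjI allI impI) auto
  qed
next
  case zero
  show ?case using T_zero sectional_carrier.zero[of P] by (metis imageI)
next
  case (add \<alpha> \<beta>)
  then obtain \<alpha>' \<beta>' where "\<alpha>' \<in> sectional_carrier P" "\<alpha> = T \<alpha>'" "\<beta>' \<in> sectional_carrier P" "\<beta> = T \<beta>'"
    by blast
  then show ?case using T_add[of \<alpha>' \<beta>'] sectional_carrier.add[of \<alpha>' P \<beta>'] by (metis imageI)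
next
  case (lscale \<alpha> r)
  then obtain \<alpha>' where "\<alpha>' \<in> sectional_carrier P" "\<alpha> = T \<alpha>'" by blast
  then show ?case using T_lscale[of \<alpha>' r] sectional_carrier.lscale[of \<alpha>' P r] by (metis imageI)
next
  case (rscale \<alpha> r)
  then obtain \<alpha>' where "\<alpha>' \<in> sectional_carrier P" "\<alpha> = T \<alpha>'" by blast
  then show ?case using T_rscale[of \<alpha>' r] sectional_carrier.rscale[of \<alpha>' P r] by (metis imageI)
qed

lemma finite_nonzero_classes:
  assumes "\<alpha> \<in> sectional_carrier P" "c \<in> arrows (base P) // EG"
  shows "finite {\<gamma> \<in> c. p (\<alpha> \<gamma>) \<noteq> fzero Q c}"
proof (rule finite_subset[OF _ finite_support_class[OF assms]], rule subsetI)
  fix \<gamma> assume "\<gamma> \<in> {\<gamma> \<in> c. p (\<alpha> \<gamma>) \<noteq> fzero Q c}"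
  then have "\<gamma> \<in> c" "p (\<alpha> \<gamma>) \<noteq> fzero Q c" by simp_all
  then show "\<gamma> \<in> {\<gamma> \<in> c. \<alpha> \<gamma> \<noteq> fzero P \<gamma>}"
    using fzero_class[OF assms(2), of \<gamma>] by (metis (mono_tags, lifting) mem_Collect_eq)
qed

lemma T_hom: "T \<in> ralgebra_hom (sectional_algebra P) (sectional_algebra Q)"
  using T_carrier T_add T_mult T_lscale T_rscale by (simp add: ralgebra_hom_def sectional_algebra_def)

end

theorem theorem5p19:
  fixes P :: "('r::topological_unital_ring, 'a, 'v, 'g, 'w) rbundle"
    and EG :: "('g \<times> 'g) set" and EL :: "('a \<times> 'a) set"
  assumes "continuous_R_bundle P"
    and "etale_semigroupoid (base P)"
    and "locally_ring_normal_space TYPE('r) (arrow_space (base P))"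
    and "bundle_congruence P EG EL"
  shows "(\<forall>\<alpha> \<in> acarrier (sectional_algebra P). \<forall>x \<in> arrows (base (quotient_bundle P EG EL)).
            finite {\<gamma> \<in> x. EL `` {\<alpha> \<gamma>} \<noteq> fzero (quotient_bundle P EG EL) x})
       \<and> quotient_sum_map P EG EL
            \<in> ralgebra_hom (sectional_algebra P) (sectional_algebra (quotient_bundle P EG EL))
       \<and> (locally_trivial_equiv (arrow_space (total P)) EL \<longrightarrow>
            quotient_sum_map P EG EL ` acarrier (sectional_algebra P)
              = acarrier (sectional_algebra (quotient_bundle P EG EL)))"
proof -
  interpret etale_bundle_quotient P EG EL
    using assms by (intro etale_bundle_quotient.intro etale_bundle_quotient_axioms.intro)
  have "acarrier (sectional_algebra P) = sectional_carrier P"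
    "acarrier (sectional_algebra Q) = sectional_carrier Q"
    by (simp_all add: sectional_algebra_def)
  moreover have "T ` sectional_carrier P = sectional_carrier Q" if "locally_trivial_equiv L EL"
    using T_carrier T_onto_if_locally_trivial[OF that] by blast
  ultimately show ?thesis
    using finite_nonzero_classes T_hom by simp
qed

end
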